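(* Let $(M^{r,3-r},\phi,\xi,\eta,g)$, $r\in\{0,1\}$, be a three-dimensional pseudo-Riemannian Sasakian space-form with $\phi$-sectional curvature $H$, and let $\psi$ be a Sasakian quasi-Killing spinor (SqK-spinor) of type $(a,b)$ with $b\neq0$. Then $g(J_\psi,\xi)$ is constant along each integral curve of the Dirac current $J_\psi$. Furthermore, $$\nabla_{J_\psi}J_\psi=(-1)^{r-1}\,b\,g(J_\psi,\xi)\;{}^\sharp(\iota_{J_\psi}d\eta),$$ that is, each integral curve of $J_\psi$ along which $g(J_\psi,\xi)\neq0$ is an orbit of a charged particle with charge $(-1)^{r-1}b\,g(J_\psi,\xi)$ in the presence of the contact Maxwell field $d\eta$.
   Context: Write $\mathrm{i}=\sqrt{-1}$; $r=0$ is the Riemannian case and $r=1$ the Lorentzian case. A Sasakian manifold is a contact metric manifold $(M,\phi,\xi,\eta,g)$ with Reeb field $\xi$, $\eta(\xi)=1$, satisfying $R(X,Y)\xi=\eta(Y)X-\eta(X)Y$; Lorentzian-Sasakian manifolds are obtained from Riemannian ones by replacing the metric $g'$ by $g'-2\eta\otimes\eta$, so $g(\xi,\xi)=(-1)^r$. The $\phi$-sectional curvature is $K(X,\phi X)$, $X\perp\xi$; a Sasakian space-form is a simply connected Sasakian manifold with constant $\phi$-sectional curvature $H$. In dimension three there is a global orthonormal frame (Sasakian frame) $e_1=\xi,e_2,e_3$, $g(e_i,e_j)=h_{ij}$, $h=\mathrm{diag}((-1)^r,1,1)$, with $[e_1,e_2]=-\frac{H+(-1)^r3}{2}e_3$,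 $[e_1,e_3]=\frac{H+(-1)^r3}{2}e_2$, $[e_2,e_3]=-2e_1$; the dual coframe is $\omega^1=\eta,\omega^2,\omega^3$, and $d\eta=2\omega^2\wedge\omega^3$. Indices are raised with $h$. Spinors: with respect to a Sasakian frame spinor fields are $\mathbb{C}^2$-valued functions, and $e_j$ acts by Clifford multiplication via $\gamma_1=(-\mathrm{i})^{r-1}\sigma_1$, $\gamma_2=\mathrm{i}\sigma_2$, $\gamma_3=\mathrm{i}\sigma_3$ ($\sigma_j$ the Pauli matrices). The spin connection is $\nabla_X\psi=X(\psi)+\omega^S(X)\psi$ with $\omega^S=\frac{(-\mathrm{i})^r}{2}\sum_j\omega^j\gamma_j+\mathrm{i}^r\frac{H+(-1)^{r-1}}{4}\omega^1\gamma_1$. An SqK-spinor of type $(a,b)$, $a,b\in\mathbb{R}$, is a spinor field with $\nabla_X\psi=a\,\mathrm{i}^rX\cdot\psi+b\,\mathrm{i}^r\eta(X)\xi\cdot\psi$ for all $X$. The Spin-invariant form is $\langle\psi_1,\psi_2\rangle=\psi_1^\dagger(\gamma_1)^r\psi_2$, and the Dirac current is $J_\psi=\sum_{j}(-\mathrm{i})^{r-1}\langle\psi,\gamma^j\psi\rangle e_j$. A Maxwell field is a closed two-form $F$; a curve $c$ is an orbit of a charged particle with charge $q$ in the presence of $F$ if $\nabla_{\dot c}\dot c=q\,{}^\sharp(\iota_{\dot c}F)$. The contact Maxwell field is $F=d\eta$. *)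

theory Defs
  imports "HOL-Analysis.Analysis"
begin

section \<open>Smooth manifolds\<close>

primrec Ck_on ::
    "nat \<Rightarrow> 'a::real_normed_vector set \<Rightarrow> ('a \<Rightarrow> 'b::real_normed_vector) \<Rightarrow> bool" where
  "Ck_on 0 S f \<longleftrightarrow> continuous_on S f"
| "Ck_on (Suc k) S f \<longleftrightarrow> (\<forall>x\<in>S. f differentiable at x) \<and>
     (\<forall>v. Ck_on k S (\<lambda>x. frechet_derivative f (at x) v))"

text \<open>Smoothness on an open subset of a finite-dimensional space; it is only used for open sets.\<close>

definition smooth_on ::
    "'a::real_normed_vector set \<Rightarrow> ('a \<Rightarrow> 'b::real_normed_vector) \<Rightarrow> bool" where
  "smooth_on S f \<longleftrightarrow> (\<forall>k. Ck_on k S f)"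

text \<open>The underlying space of a manifold is a whole type \<open>'m\<close>, its smooth structure is given by an
  atlas of charts \<open>(U, \<kappa>)\<close> with values in a Euclidean space.  The atlas need not be maximal.\<close>

type_synonym ('m, 'e) atlas = "('m set \<times> ('m \<Rightarrow> 'e)) set"

definition smooth_atlas ::
    "('m::{t2_space,second_countable_topology}, 'e::euclidean_space) atlas \<Rightarrow> bool" where
  "smooth_atlas A \<longleftrightarrow>
     (\<Union>(U, \<kappa>)\<in>A. U) = UNIV \<and>
     (\<forall>(U, \<kappa>)\<in>A. open U \<and> open (\<kappa> ` U) \<and> homeomorphism U (\<kappa> ` U) \<kappa> (inv_into U \<kappa>)) \<and>
     (\<forall>(U, \<kappa>)\<in>A. \<forall>(V, \<mu>)\<in>A. smooth_on (\<kappa> ` (U \<inter> V)) (\<mu> \<circ> inv_into U \<kappa>))"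

definition smooth_fun ::
    "('m::{t2_space,second_countable_topology}, 'e::euclidean_space) atlas \<Rightarrow> ('m \<Rightarrow> real) \<Rightarrow> bool" where
  "smooth_fun A f \<longleftrightarrow> (\<forall>(U, \<kappa>)\<in>A. smooth_on (\<kappa> ` U) (f \<circ> inv_into U \<kappa>))"

text \<open>A tangent vector at \<open>p\<close> is a derivation at \<open>p\<close> of the algebra of smooth functions.  As
  functions are total, it is extended by \<open>0\<close> to the functions that are not smooth, so that equality
  of tangent vectors is equality of derivations.\<close>

type_synonym 'm tvec = "('m \<Rightarrow> real) \<Rightarrow> real"
type_synonym 'm vfield = "'m \<Rightarrow> 'm tvec"

definition tplus :: "'m tvec \<Rightarrow> 'm tvec \<Rightarrow> 'm tvec" (infixl "\<oplus>\<^sub>t" 65) where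
  "v \<oplus>\<^sub>t w = (\<lambda>f. v f + w f)"

definition tscale :: "real \<Rightarrow> 'm tvec \<Rightarrow> 'm tvec" (infixr "\<odot>\<^sub>t" 75) where
  "c \<odot>\<^sub>t v = (\<lambda>f. c * v f)"

definition tzero :: "'m tvec" where
  "tzero = (\<lambda>f. 0)"

definition tangent_space ::
    "('m::{t2_space,second_countable_topology}, 'e::euclidean_space) atlas \<Rightarrow> 'm \<Rightarrow> 'm tvec set" where
  "tangent_space A p = {v.
     (\<forall>f h. smooth_fun A f \<longrightarrow> smooth_fun A h \<longrightarrow> v (\<lambda>x. f x + h x) = v f + v h) \<and>
     (\<forall>c f. smooth_fun A f \<longrightarrow> v (\<lambda>x. c * f x) = c * v f) \<and>
     (\<forall>f h. smooth_fun A f \<longrightarrow> smooth_fun A h \<longrightarrow> v (\<lambda>x. f x * h x) = f p * v h + h p * v f) \<and>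
     (\<forall>f. \<not> smooth_fun A f \<longrightarrow> v f = 0)}"

definition vector_field ::
    "('m::{t2_space,second_countable_topology}, 'e::euclidean_space) atlas \<Rightarrow> 'm vfield \<Rightarrow> bool" where
  "vector_field A X \<longleftrightarrow> (\<forall>p. X p \<in> tangent_space A p) \<and>
     (\<forall>f. smooth_fun A f \<longrightarrow> smooth_fun A (\<lambda>p. X p f))"

definition lie_bracket :: "'m vfield \<Rightarrow> 'm vfield \<Rightarrow> 'm vfield" where
  "lie_bracket X Y = (\<lambda>p f. X p (\<lambda>q. Y q f) - Y p (\<lambda>q. X q f))"


section \<open>Tensor fields and forms\<close>

text \<open>The values of tensor fields on arguments that are not tangent vectors are irrelevant.\<close>

definition one_form ::
    "('m::{t2_space,second_countable_topology}, 'e::euclidean_space) atlas \<Rightarrow>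
     ('m \<Rightarrow> 'm tvec \<Rightarrow> real) \<Rightarrow> bool" where
  "one_form A \<alpha> \<longleftrightarrow>
     (\<forall>p. \<forall>v\<in>tangent_space A p. \<forall>w\<in>tangent_space A p. \<forall>c.
        \<alpha> p (v \<oplus>\<^sub>t w) = \<alpha> p v + \<alpha> p w \<and> \<alpha> p (c \<odot>\<^sub>t v) = c * \<alpha> p v) \<and>
     (\<forall>X. vector_field A X \<longrightarrow> smooth_fun A (\<lambda>p. \<alpha> p (X p)))"

definition endomorphism_field ::
    "('m::{t2_space,second_countable_topology}, 'e::euclidean_space) atlas \<Rightarrow>
     ('m \<Rightarrow> 'm tvec \<Rightarrow> 'm tvec) \<Rightarrow> bool" where
  "endomorphism_field A \<phi> \<longleftrightarrow>
     (\<forall>p. \<forall>v\<in>tangent_space A p. \<forall>w\<in>tangent_space A p. \<forall>c.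
        \<phi> p (v \<oplus>\<^sub>t w) = \<phi> p v \<oplus>\<^sub>t \<phi> p w \<and> \<phi> p (c \<odot>\<^sub>t v) = c \<odot>\<^sub>t \<phi> p v) \<and>
     (\<forall>X. vector_field A X \<longrightarrow> vector_field A (\<lambda>p. \<phi> p (X p))) \<and>
     (\<forall>p. \<forall>v\<in>tangent_space A p. \<phi> p v \<in> tangent_space A p)"

definition bilinear_field ::
    "('m::{t2_space,second_countable_topology}, 'e::euclidean_space) atlas \<Rightarrow>
     ('m \<Rightarrow> 'm tvec \<Rightarrow> 'm tvec \<Rightarrow> real) \<Rightarrow> bool" where
  "bilinear_field A B \<longleftrightarrow>
     (\<forall>p. \<forall>u\<in>tangent_space A p. \<forall>v\<in>tangent_space A p. \<forall>w\<in>tangent_space A p. \<forall>c.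
        B p (u \<oplus>\<^sub>t v) w = B p u w + B p v w \<and> B p (c \<odot>\<^sub>t u) w = c * B p u w \<and>
        B p w (u \<oplus>\<^sub>t v) = B p w u + B p w v \<and> B p w (c \<odot>\<^sub>t u) = c * B p w u) \<and>
     (\<forall>X Y. vector_field A X \<longrightarrow> vector_field A Y \<longrightarrow> smooth_fun A (\<lambda>p. B p (X p) (Y p)))"

definition two_form ::
    "('m::{t2_space,second_countable_topology}, 'e::euclidean_space) atlas \<Rightarrow>
     ('m \<Rightarrow> 'm tvec \<Rightarrow> 'm tvec \<Rightarrow> real) \<Rightarrow> bool" where
  "two_form A F \<longleftrightarrow> bilinear_field A F \<and>
     (\<forall>p. \<forall>v\<in>tangent_space A p. F p v v = 0)"

text \<open>The exterior derivative is normalised by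
  \<open>d\<alpha>(X, Y) = X \<alpha>(Y) - Y \<alpha>(X) - \<alpha>([X, Y])\<close>, without a factor \<open>1/2\<close>.  The right-hand side at \<open>p\<close>
  depends only on \<open>X p\<close> and \<open>Y p\<close>, hence the definite description.\<close>

definition ext_deriv1 ::
    "('m::{t2_space,second_countable_topology}, 'e::euclidean_space) atlas \<Rightarrow>
     ('m \<Rightarrow> 'm tvec \<Rightarrow> real) \<Rightarrow> ('m \<Rightarrow> 'm tvec \<Rightarrow> 'm tvec \<Rightarrow> real)" where
  "ext_deriv1 A \<alpha> p v w = (THE c. \<exists>X Y. vector_field A X \<and> vector_field A Y \<and> X p = v \<and> Y p = w \<and>
     c = X p (\<lambda>q. \<alpha> q (Y q)) - Y p (\<lambda>q. \<alpha> q (X q)) - \<alpha> p (lie_bracket X Y p))"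

definition closed_two_form ::
    "('m::{t2_space,second_countable_topology}, 'e::euclidean_space) atlas \<Rightarrow>
     ('m \<Rightarrow> 'm tvec \<Rightarrow> 'm tvec \<Rightarrow> real) \<Rightarrow> bool" where
  "closed_two_form A F \<longleftrightarrow> two_form A F \<and>
     (\<forall>X Y Z p. vector_field A X \<longrightarrow> vector_field A Y \<longrightarrow> vector_field A Z \<longrightarrow>
        X p (\<lambda>q. F q (Y q) (Z q)) + Y p (\<lambda>q. F q (Z q) (X q)) + Z p (\<lambda>q. F q (X q) (Y q))
        - F p (lie_bracket X Y p) (Z p) - F p (lie_bracket Y Z p) (X p)
        - F p (lie_bracket Z X p) (Y p) = 0)"

definition riemannian_metric ::
    "('m::{t2_space,second_countable_topology}, 'e::euclidean_space) atlas \<Rightarrow>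
     ('m \<Rightarrow> 'm tvec \<Rightarrow> 'm tvec \<Rightarrow> real) \<Rightarrow> bool" where
  "riemannian_metric A g \<longleftrightarrow> bilinear_field A g \<and>
     (\<forall>p. \<forall>v\<in>tangent_space A p. \<forall>w\<in>tangent_space A p. g p v w = g p w v) \<and>
     (\<forall>p. \<forall>v\<in>tangent_space A p. v \<noteq> tzero \<longrightarrow> g p v v > 0)"

text \<open>\<open>sharp A g p \<alpha>\<close> is the vector metrically dual to the covector \<open>\<alpha>\<close> at \<open>p\<close>.\<close>

definition sharp ::
    "('m::{t2_space,second_countable_topology}, 'e::euclidean_space) atlas \<Rightarrow>
     ('m \<Rightarrow> 'm tvec \<Rightarrow> 'm tvec \<Rightarrow> real) \<Rightarrow> 'm \<Rightarrow> ('m tvec \<Rightarrow> real) \<Rightarrow> 'm tvec" where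
  "sharp A g p \<alpha> =
     (THE v. v \<in> tangent_space A p \<and> (\<forall>w\<in>tangent_space A p. g p v w = \<alpha> w))"


section \<open>Levi-Civita connection and curvature\<close>

text \<open>\<open>D X Y\<close> is the covariant derivative of \<open>Y\<close> in direction \<open>X\<close>.  On vector fields \<open>D\<close> is
  uniquely determined by the pseudo-Riemannian metric \<open>g\<close>.\<close>

definition levi_civita ::
    "('m::{t2_space,second_countable_topology}, 'e::euclidean_space) atlas \<Rightarrow>
     ('m \<Rightarrow> 'm tvec \<Rightarrow> 'm tvec \<Rightarrow> real) \<Rightarrow> ('m vfield \<Rightarrow> 'm vfield \<Rightarrow> 'm vfield) \<Rightarrow> bool" where
  "levi_civita A g D \<longleftrightarrow>
     (\<forall>X Y. vector_field A X \<longrightarrow> vector_field A Y \<longrightarrow> vector_field A (D X Y)) \<and>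
     (\<forall>X X' Y. vector_field A X \<longrightarrow> vector_field A X' \<longrightarrow> vector_field A Y \<longrightarrow>
        D (\<lambda>p. X p \<oplus>\<^sub>t X' p) Y = (\<lambda>p. D X Y p \<oplus>\<^sub>t D X' Y p)) \<and>
     (\<forall>f X Y. smooth_fun A f \<longrightarrow> vector_field A X \<longrightarrow> vector_field A Y \<longrightarrow>
        D (\<lambda>p. f p \<odot>\<^sub>t X p) Y = (\<lambda>p. f p \<odot>\<^sub>t D X Y p)) \<and>
     (\<forall>X Y Y'. vector_field A X \<longrightarrow> vector_field A Y \<longrightarrow> vector_field A Y' \<longrightarrow>
        D X (\<lambda>p. Y p \<oplus>\<^sub>t Y' p) = (\<lambda>p. D X Y p \<oplus>\<^sub>t D X Y' p)) \<and>
     (\<forall>f X Y. smooth_fun A f \<longrightarrow> vector_field A X \<longrightarrow> vector_field A Y \<longrightarrow>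
        D X (\<lambda>p. f p \<odot>\<^sub>t Y p) = (\<lambda>p. X p f \<odot>\<^sub>t Y p \<oplus>\<^sub>t f p \<odot>\<^sub>t D X Y p)) \<and>
     (\<forall>X Y p. vector_field A X \<longrightarrow> vector_field A Y \<longrightarrow>
        D X Y p \<oplus>\<^sub>t (-1) \<odot>\<^sub>t D Y X p = lie_bracket X Y p) \<and>
     (\<forall>X Y Z p. vector_field A X \<longrightarrow> vector_field A Y \<longrightarrow> vector_field A Z \<longrightarrow>
        X p (\<lambda>q. g q (Y q) (Z q)) = g p (D X Y p) (Z p) + g p (Y p) (D X Z p))"

definition curvature ::
    "('m vfield \<Rightarrow> 'm vfield \<Rightarrow> 'm vfield) \<Rightarrow> 'm vfield \<Rightarrow> 'm vfield \<Rightarrow> 'm vfield \<Rightarrow> 'm vfield" where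
  "curvature D X Y Z p =
     D X (D Y Z) p \<oplus>\<^sub>t (-1) \<odot>\<^sub>t D Y (D X Z) p \<oplus>\<^sub>t (-1) \<odot>\<^sub>t D (lie_bracket X Y) Z p"

definition sectional_curvature ::
    "('m \<Rightarrow> 'm tvec \<Rightarrow> 'm tvec \<Rightarrow> real) \<Rightarrow> ('m vfield \<Rightarrow> 'm vfield \<Rightarrow> 'm vfield) \<Rightarrow>
     'm vfield \<Rightarrow> 'm vfield \<Rightarrow> 'm \<Rightarrow> real" where
  "sectional_curvature g D X Y p =
     g p (curvature D X Y Y p) (X p) /
       (g p (X p) (X p) * g p (Y p) (Y p) - (g p (X p) (Y p))\<^sup>2)"


section \<open>Sasakian space-forms\<close>

text \<open>The contact metric condition \<open>d\<eta>(X, Y) = 2 g(X, \<phi> Y)\<close> is Blair's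
  \<open>d\<eta>(X, Y) = g(X, \<phi> Y)\<close>, whose exterior derivative carries a factor \<open>1/2\<close>.\<close>

definition contact_metric ::
    "('m::{t2_space,second_countable_topology}, 'e::euclidean_space) atlas \<Rightarrow>
     ('m \<Rightarrow> 'm tvec \<Rightarrow> 'm tvec) \<Rightarrow> 'm vfield \<Rightarrow> ('m \<Rightarrow> 'm tvec \<Rightarrow> real) \<Rightarrow>
     ('m \<Rightarrow> 'm tvec \<Rightarrow> 'm tvec \<Rightarrow> real) \<Rightarrow> bool" where
  "contact_metric A \<phi> \<xi> \<eta> g \<longleftrightarrow>
     endomorphism_field A \<phi> \<and> vector_field A \<xi> \<and> one_form A \<eta> \<and> riemannian_metric A g \<and>
     (\<forall>p. \<eta> p (\<xi> p) = 1) \<and>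
     (\<forall>p. \<forall>v\<in>tangent_space A p. \<phi> p (\<phi> p v) = (-1) \<odot>\<^sub>t v \<oplus>\<^sub>t \<eta> p v \<odot>\<^sub>t \<xi> p) \<and>
     (\<forall>p. \<forall>v\<in>tangent_space A p. \<forall>w\<in>tangent_space A p.
        g p (\<phi> p v) (\<phi> p w) = g p v w - \<eta> p v * \<eta> p w \<and>
        ext_deriv1 A \<eta> p v w = 2 * g p v (\<phi> p w))"

definition sasakian ::
    "('m::{t2_space,second_countable_topology}, 'e::euclidean_space) atlas \<Rightarrow>
     ('m \<Rightarrow> 'm tvec \<Rightarrow> 'm tvec) \<Rightarrow> 'm vfield \<Rightarrow> ('m \<Rightarrow> 'm tvec \<Rightarrow> real) \<Rightarrow>
     ('m \<Rightarrow> 'm tvec \<Rightarrow> 'm tvec \<Rightarrow> real) \<Rightarrow> bool" where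
  "sasakian A \<phi> \<xi> \<eta> g \<longleftrightarrow> contact_metric A \<phi> \<xi> \<eta> g \<and>
     (\<exists>D. levi_civita A g D \<and>
       (\<forall>X Y p. vector_field A X \<longrightarrow> vector_field A Y \<longrightarrow>
          curvature D X Y \<xi> p = \<eta> p (Y p) \<odot>\<^sub>t X p \<oplus>\<^sub>t (- \<eta> p (X p)) \<odot>\<^sub>t Y p))"

text \<open>For \<open>r = 0\<close> this is the Riemannian and for \<open>r = 1\<close> the Lorentzian case, in which
  \<open>g = g' - 2 \<eta> \<otimes> \<eta>\<close> for a Riemannian Sasakian metric \<open>g'\<close>.\<close>

definition pseudo_sasakian ::
    "nat \<Rightarrow> ('m::{t2_space,second_countable_topology}, 'e::euclidean_space) atlas \<Rightarrow>
     ('m \<Rightarrow> 'm tvec \<Rightarrow> 'm tvec) \<Rightarrow> 'm vfield \<Rightarrow> ('m \<Rightarrow> 'm tvec \<Rightarrow> real) \<Rightarrow>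
     ('m \<Rightarrow> 'm tvec \<Rightarrow> 'm tvec \<Rightarrow> real) \<Rightarrow> bool" where
  "pseudo_sasakian r A \<phi> \<xi> \<eta> g \<longleftrightarrow>
     (\<exists>g'. sasakian A \<phi> \<xi> \<eta> g' \<and>
       (\<forall>p. \<forall>v\<in>tangent_space A p. \<forall>w\<in>tangent_space A p.
          g p v w = (if r = 0 then g' p v w else g' p v w - 2 * \<eta> p v * \<eta> p w)))"

text \<open>\<open>D\<close> is the Levi-Civita connection of \<open>g\<close> and \<open>H\<close> is the \<open>\<phi>\<close>-sectional curvature of \<open>g\<close>
  (not of \<open>g'\<close>).\<close>

definition sasakian_space_form ::
    "nat \<Rightarrow> real \<Rightarrow> ('m::{t2_space,second_countable_topology}, 'e::euclidean_space) atlas \<Rightarrow>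
     ('m \<Rightarrow> 'm tvec \<Rightarrow> 'm tvec) \<Rightarrow> 'm vfield \<Rightarrow> ('m \<Rightarrow> 'm tvec \<Rightarrow> real) \<Rightarrow>
     ('m \<Rightarrow> 'm tvec \<Rightarrow> 'm tvec \<Rightarrow> real) \<Rightarrow> ('m vfield \<Rightarrow> 'm vfield \<Rightarrow> 'm vfield) \<Rightarrow> bool" where
  "sasakian_space_form r H A \<phi> \<xi> \<eta> g D \<longleftrightarrow>
     smooth_atlas A \<and> simply_connected (UNIV :: 'm set) \<and>
     pseudo_sasakian r A \<phi> \<xi> \<eta> g \<and> levi_civita A g D \<and>
     (\<forall>X p. vector_field A X \<longrightarrow> X p \<noteq> tzero \<longrightarrow> g p (X p) (\<xi> p) = 0 \<longrightarrow>
        sectional_curvature g D X (\<lambda>q. \<phi> q (X q)) p = H)"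


section \<open>Sasakian frames\<close>

definition frame ::
    "('m::{t2_space,second_countable_topology}, 'e::euclidean_space) atlas \<Rightarrow> (3 \<Rightarrow> 'm vfield) \<Rightarrow> bool" where
  "frame A e \<longleftrightarrow> (\<forall>i. vector_field A (e i)) \<and>
     (\<forall>p. \<forall>v\<in>tangent_space A p. \<exists>!c::real^3. v = (\<lambda>f. \<Sum>i\<in>UNIV. c $ i * e i p f))"

definition coframe :: "(3 \<Rightarrow> 'm vfield) \<Rightarrow> 'm \<Rightarrow> 'm tvec \<Rightarrow> real^3" where
  "coframe e p v = (THE c. v = (\<lambda>f. \<Sum>i\<in>UNIV. c $ i * e i p f))"

definition hmat :: "nat \<Rightarrow> real^3^3" where
  "hmat r = (\<chi> i j. if i = j then (if i = 1 then (-1) ^ r else 1) else 0)"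

definition sasakian_frame ::
    "nat \<Rightarrow> real \<Rightarrow> ('m::{t2_space,second_countable_topology}, 'e::euclidean_space) atlas \<Rightarrow>
     'm vfield \<Rightarrow> ('m \<Rightarrow> 'm tvec \<Rightarrow> 'm tvec \<Rightarrow> real) \<Rightarrow> (3 \<Rightarrow> 'm vfield) \<Rightarrow> bool" where
  "sasakian_frame r H A \<xi> g e \<longleftrightarrow> frame A e \<and> e 1 = \<xi> \<and>
     (\<forall>p i j. g p (e i p) (e j p) = hmat r $ i $ j) \<and>
     (\<forall>p. lie_bracket (e 1) (e 2) p = (- ((H + (-1) ^ r * 3) / 2)) \<odot>\<^sub>t e 3 p) \<and>
     (\<forall>p. lie_bracket (e 1) (e 3) p = ((H + (-1) ^ r * 3) / 2) \<odot>\<^sub>t e 2 p) \<and>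
     (\<forall>p. lie_bracket (e 2) (e 3) p = (-2) \<odot>\<^sub>t e 1 p)"


section \<open>Spinors with respect to a Sasakian frame\<close>

definition pauli :: "3 \<Rightarrow> complex^2^2" where
  "pauli j =
     (if j = 1 then vector [vector [0, 1], vector [1, 0]]
      else if j = 2 then vector [vector [0, -\<i>], vector [\<i>, 0]]
      else vector [vector [1, 0], vector [0, -1]])"

text \<open>Clifford multiplication by the frame vector \<open>e j\<close>.\<close>

definition gamma :: "nat \<Rightarrow> 3 \<Rightarrow> complex^2 \<Rightarrow> complex^2" where
  "gamma r j u = (if j = 1 then (-\<i>) powi (int r - 1) else \<i>) *s (pauli j *v u)"

text \<open>The index of \<open>\<gamma>\<close> is raised with \<open>h\<close>, which is its own inverse.\<close>

definition gamma_up :: "nat \<Rightarrow> 3 \<Rightarrow> complex^2 \<Rightarrow> complex^2" where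
  "gamma_up r j u = (\<Sum>k\<in>UNIV. of_real (hmat r $ j $ k) *s gamma r k u)"

definition clifford ::
    "nat \<Rightarrow> (3 \<Rightarrow> 'm vfield) \<Rightarrow> 'm \<Rightarrow> 'm tvec \<Rightarrow> complex^2 \<Rightarrow> complex^2" where
  "clifford r e p v u = (\<Sum>j\<in>UNIV. of_real (coframe e p v $ j) *s gamma r j u)"

definition spinor_field ::
    "('m::{t2_space,second_countable_topology}, 'e::euclidean_space) atlas \<Rightarrow> ('m \<Rightarrow> complex^2) \<Rightarrow> bool" where
  "spinor_field A \<psi> \<longleftrightarrow>
     (\<forall>k. smooth_fun A (\<lambda>p. Re (\<psi> p $ k)) \<and> smooth_fun A (\<lambda>p. Im (\<psi> p $ k)))"

definition spinor_deriv :: "'m tvec \<Rightarrow> ('m \<Rightarrow> complex^2) \<Rightarrow> complex^2" where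
  "spinor_deriv v \<psi> = (\<chi> k. Complex (v (\<lambda>p. Re (\<psi> p $ k))) (v (\<lambda>p. Im (\<psi> p $ k))))"

definition spin_connection_form ::
    "nat \<Rightarrow> real \<Rightarrow> (3 \<Rightarrow> 'm vfield) \<Rightarrow> 'm \<Rightarrow> 'm tvec \<Rightarrow> complex^2 \<Rightarrow> complex^2" where
  "spin_connection_form r H e p v u =
     ((-\<i>) ^ r / 2) *s (\<Sum>j\<in>UNIV. of_real (coframe e p v $ j) *s gamma r j u)
     + (\<i> ^ r * of_real ((H + (-1) powi (int r - 1)) / 4) * of_real (coframe e p v $ 1)) *s gamma r 1 u"

definition spin_covariant_deriv ::
    "nat \<Rightarrow> real \<Rightarrow> (3 \<Rightarrow> 'm vfield) \<Rightarrow> 'm \<Rightarrow> 'm tvec \<Rightarrow> ('m \<Rightarrow> complex^2) \<Rightarrow> complex^2" where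
  "spin_covariant_deriv r H e p v \<psi> = spinor_deriv v \<psi> + spin_connection_form r H e p v (\<psi> p)"

definition sqk_spinor ::
    "nat \<Rightarrow> real \<Rightarrow> ('m::{t2_space,second_countable_topology}, 'e::euclidean_space) atlas \<Rightarrow>
     'm vfield \<Rightarrow> ('m \<Rightarrow> 'm tvec \<Rightarrow> real) \<Rightarrow> (3 \<Rightarrow> 'm vfield) \<Rightarrow>
     real \<Rightarrow> real \<Rightarrow> ('m \<Rightarrow> complex^2) \<Rightarrow> bool" where
  "sqk_spinor r H A \<xi> \<eta> e a b \<psi> \<longleftrightarrow> spinor_field A \<psi> \<and>
     (\<forall>X p. vector_field A X \<longrightarrow>
        spin_covariant_deriv r H e p (X p) \<psi> =
          (of_real a * \<i> ^ r) *s clifford r e p (X p) (\<psi> p)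
          + (of_real b * \<i> ^ r * of_real (\<eta> p (X p))) *s clifford r e p (\<xi> p) (\<psi> p))"

definition spin_form :: "nat \<Rightarrow> complex^2 \<Rightarrow> complex^2 \<Rightarrow> complex" where
  "spin_form r u1 u2 = (\<Sum>k\<in>UNIV. cnj (u1 $ k) * ((gamma r 1 ^^ r) u2) $ k)"

definition dirac_coeff :: "nat \<Rightarrow> complex^2 \<Rightarrow> 3 \<Rightarrow> complex" where
  "dirac_coeff r u j = (-\<i>) powi (int r - 1) * spin_form r u (gamma_up r j u)"

lemma dirac_coeff_real:
  assumes "r \<in> {0, 1}"
  shows "dirac_coeff r u j \<in> \<real>"
proof -
  have j: "j = 1 \<or> j = 2 \<or> j = 3"
    by (rule exhaust_3)
  show ?thesis
    using assms j
    by (auto simp: dirac_coeff_def spin_form_def gamma_up_def gamma_def pauli_def hmat_def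
        sum_2 sum_3 matrix_vector_mult_def complex_is_Real_iff power_int_minus field_simps)
qed

text \<open>Taking real parts loses nothing by \<open>dirac_coeff_real\<close>.\<close>

definition dirac_current :: "nat \<Rightarrow> (3 \<Rightarrow> 'm vfield) \<Rightarrow> ('m \<Rightarrow> complex^2) \<Rightarrow> 'm vfield" where
  "dirac_current r e \<psi> p = (\<lambda>f. \<Sum>j\<in>UNIV. Re (dirac_coeff r (\<psi> p) j) * e j p f)"


section \<open>Curves and orbits of charged particles\<close>

text \<open>Curves are parametrised by open intervals.\<close>

definition smooth_curve ::
    "('m::{t2_space,second_countable_topology}, 'e::euclidean_space) atlas \<Rightarrow>
     real set \<Rightarrow> (real \<Rightarrow> 'm) \<Rightarrow> bool" where
  "smooth_curve A I c \<longleftrightarrow> open I \<and> is_interval I \<and> continuous_on I c \<and>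
     (\<forall>(U, \<kappa>)\<in>A. smooth_on (I \<inter> c -` U) (\<kappa> \<circ> c))"

definition velocity ::
    "('m::{t2_space,second_countable_topology}, 'e::euclidean_space) atlas \<Rightarrow>
     (real \<Rightarrow> 'm) \<Rightarrow> real \<Rightarrow> 'm tvec" where
  "velocity A c t = (\<lambda>f. if smooth_fun A f then deriv (f \<circ> c) t else 0)"

definition integral_curve ::
    "('m::{t2_space,second_countable_topology}, 'e::euclidean_space) atlas \<Rightarrow>
     'm vfield \<Rightarrow> real set \<Rightarrow> (real \<Rightarrow> 'm) \<Rightarrow> bool" where
  "integral_curve A X I c \<longleftrightarrow> smooth_curve A I c \<and> (\<forall>t\<in>I. velocity A c t = X (c t))"

definition vector_field_along ::
    "('m::{t2_space,second_countable_topology}, 'e::euclidean_space) atlas \<Rightarrow>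
     real set \<Rightarrow> (real \<Rightarrow> 'm) \<Rightarrow> (real \<Rightarrow> 'm tvec) \<Rightarrow> bool" where
  "vector_field_along A I c V \<longleftrightarrow> (\<forall>t\<in>I. V t \<in> tangent_space A (c t)) \<and>
     (\<forall>f. smooth_fun A f \<longrightarrow> smooth_on I (\<lambda>t. V t f))"

text \<open>The covariant derivative along the curve \<open>c\<close> induced by the connection \<open>D\<close>: the operator on
  vector fields along \<open>c\<close> that is additive, satisfies the Leibniz rule and agrees with \<open>D\<close> on
  restrictions of vector fields.  On vector fields along \<open>c\<close>, at times in \<open>I\<close>, these conditions
  determine \<open>Dt\<close> uniquely.\<close>

definition covariant_deriv_along ::
    "('m::{t2_space,second_countable_topology}, 'e::euclidean_space) atlas \<Rightarrow>
     ('m vfield \<Rightarrow> 'm vfield \<Rightarrow> 'm vfield) \<Rightarrow> real set \<Rightarrow> (real \<Rightarrow> 'm) \<Rightarrow>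
     ((real \<Rightarrow> 'm tvec) \<Rightarrow> real \<Rightarrow> 'm tvec) \<Rightarrow> bool" where
  "covariant_deriv_along A D I c Dt \<longleftrightarrow>
     (\<forall>V. vector_field_along A I c V \<longrightarrow> (\<forall>t\<in>I. Dt V t \<in> tangent_space A (c t))) \<and>
     (\<forall>V W. vector_field_along A I c V \<longrightarrow> vector_field_along A I c W \<longrightarrow>
        (\<forall>t\<in>I. Dt (\<lambda>s. V s \<oplus>\<^sub>t W s) t = Dt V t \<oplus>\<^sub>t Dt W t)) \<and>
     (\<forall>f V. smooth_on I f \<longrightarrow> vector_field_along A I c V \<longrightarrow>
        (\<forall>t\<in>I. Dt (\<lambda>s. f s \<odot>\<^sub>t V s) t = deriv f t \<odot>\<^sub>t V t \<oplus>\<^sub>t f t \<odot>\<^sub>t Dt V t)) \<and>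
     (\<forall>V Y. vector_field_along A I c V \<longrightarrow> vector_field A Y \<longrightarrow> (\<forall>t\<in>I. V t = Y (c t)) \<longrightarrow>
        (\<forall>t\<in>I. \<forall>X. vector_field A X \<longrightarrow> X (c t) = velocity A c t \<longrightarrow> Dt V t = D X Y (c t)))"

definition charged_particle_orbit ::
    "('m::{t2_space,second_countable_topology}, 'e::euclidean_space) atlas \<Rightarrow>
     ('m \<Rightarrow> 'm tvec \<Rightarrow> 'm tvec \<Rightarrow> real) \<Rightarrow> ('m vfield \<Rightarrow> 'm vfield \<Rightarrow> 'm vfield) \<Rightarrow>
     ('m \<Rightarrow> 'm tvec \<Rightarrow> 'm tvec \<Rightarrow> real) \<Rightarrow> real \<Rightarrow> real set \<Rightarrow> (real \<Rightarrow> 'm) \<Rightarrow> bool" where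
  "charged_particle_orbit A g D F q I c \<longleftrightarrow> closed_two_form A F \<and> smooth_curve A I c \<and>
     (\<exists>Dt. covariant_deriv_along A D I c Dt \<and>
       (\<forall>t\<in>I. Dt (velocity A c) t = q \<odot>\<^sub>t sharp A g (c t) (F (c t) (velocity A c t))))"

end

theory Submission
  imports Defs
begin

text \<open>The metric form of the Levi-Civita equations gives
  \<open>g(D\<^sub>J J, e\<^sub>k) = J(g(J, e\<^sub>k)) - \<Sum>\<^sub>i J\<^sup>i g(J, [e\<^sub>i, e\<^sub>k])\<close> for a field \<open>J\<close> and an orthonormal frame, so
  no Christoffel symbols are needed.  The spinor equation says
  \<open>e\<^sub>i \<psi> = (\<alpha> + \<delta>\<^sub>i\<^sub>1 \<beta>) \<i>\<^sup>r \<gamma>\<^sub>i \<psi>\<close> with \<open>\<alpha> = a - (-1)\<^sup>r/2\<close> and \<open>\<beta> = b - (H - (-1)\<^sup>r)/4\<close>, whence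
  \<open>J(J\<^sup>1) = 0\<close>, \<open>J(J\<^sup>2) = 2\<beta> J\<^sup>1 J\<^sup>3\<close> and \<open>J(J\<^sup>3) = -2\<beta> J\<^sup>1 J\<^sup>2\<close>.  The structure constants of the frame
  replace \<open>\<beta>\<close> by \<open>b\<close>, which leaves the Lorentz force of \<open>d\<eta> = 2 \<omega>\<^sup>2 \<and> \<omega>\<^sup>3\<close>.\<close>


section \<open>Smooth functions\<close>

text \<open>The laborious part is the orbit statement: it asks for a covariant derivative along each
  integral curve, acting also on fields along the curve that are restrictions of no vector field.
  Such an operator is written down in frame components, and its Leibniz rule requires those
  components to be differentiable in time, although a field along a curve is only tested on globally
  smooth functions. \<open>ext_deriv1\<close> and \<open>sharp\<close> are definite descriptions, so
  tensoriality of the one and nondegeneracy for the other precede every computation with them. The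
  frame is global, which replaces bump functions and coordinates: constant coefficients extend a
  tangent vector to a field, and the metric extracts components as smooth functions. Charts are
  opened only to show that sums and products of smooth functions are smooth and that smooth
  functions are differentiable along curves. The parameter \<alpha> leaves no trace in the force
  because its contribution is a cross product of J with itself.\<close>

lemma Ck_on_cong:
  assumes "open S" "\<And>x. x \<in> S \<Longrightarrow> f x = g x" "Ck_on k S f"
  shows "Ck_on k S g"
  using assms(2,3)
proof (induction k arbitrary: f g)
  case 0
  then show ?case using continuous_on_cong[of S S f g] by simp
next
  case (Suc k)
  \<comment> \<open>Since \<open>S\<close> is open, agreement on \<open>S\<close> is agreement near
    \<open>x\<close>, so derivatives transfer from \<open>f\<close> to \<open>g\<close>.\<close>
  have d: "(g has_derivative f') (at x)" if "(f has_derivative f') (at x)" "x \<in> S" for x f'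
    using has_derivative_transform_within_open[OF that(1) \<open>open S\<close> that(2) Suc.prems(1)] .
  have eq: "frechet_derivative f (at x) = frechet_derivative g (at x)" if "x \<in> S" for x
    using d[OF _ that] Suc.prems(2) that
    by (metis Ck_on.simps(2) frechet_derivative_at frechet_derivative_works)
  have "g differentiable at x" if "x \<in> S" for x
    using d[OF _ that] Suc.prems(2) that by (metis Ck_on.simps(2) differentiable_def)
  moreover have "Ck_on k S (\<lambda>x. frechet_derivative g (at x) v)" for v
    using Suc.IH[of "\<lambda>x. frechet_derivative f (at x) v" "\<lambda>x. frechet_derivative g (at x) v"]
      eq Suc.prems(2) by auto
  ultimately show ?case by simp
qed

lemma Ck_on_SucD: "Ck_on (Suc k) S f \<Longrightarrow> Ck_on k S f"
proof (induction k arbitrary: f)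
  case 0
  then show ?case
    by (auto intro!: continuous_at_imp_continuous_on differentiable_imp_continuous_within)
next
  case (Suc k)
  then show ?case by (metis Ck_on.simps(2))
qed

lemma Ck_on_const: "Ck_on k S (\<lambda>x. c)"
proof (induction k arbitrary: c)
  case (Suc k)
  then show ?case by simp
qed simp

lemma frechet_derivative_add_at:
  assumes "f differentiable at x" "g differentiable at x"
  shows "frechet_derivative (\<lambda>x. f x + g x) (at x) v =
    frechet_derivative f (at x) v + frechet_derivative g (at x) v"
  using has_derivative_add[OF assms[unfolded frechet_derivative_works]]
  by (simp add: frechet_derivative_at[symmetric])

lemma frechet_derivative_mult_at:
  fixes f g :: "'a::real_normed_vector \<Rightarrow> real"
  assumes "f differentiable at x" "g differentiable at x"
  shows "frechet_derivative (\<lambda>x. f x * g x) (at x) v =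
    f x * frechet_derivative g (at x) v + frechet_derivative f (at x) v * g x"
  using has_derivative_mult[OF assms[unfolded frechet_derivative_works]]
  by (simp add: frechet_derivative_at[symmetric])

lemma Ck_on_add:
  assumes "open S" "Ck_on k S f" "Ck_on k S g"
  shows "Ck_on k S (\<lambda>x. f x + g x)"
  using assms(2,3)
proof (induction k arbitrary: f g)
  case 0
  then show ?case by (simp add: continuous_on_add)
next
  case (Suc k)
  have "Ck_on k S (\<lambda>x. frechet_derivative (\<lambda>x. f x + g x) (at x) v)" for v
    by (rule Ck_on_cong[OF \<open>open S\<close> _ Suc.IH[of "\<lambda>x. frechet_derivative f (at x) v"
            "\<lambda>x. frechet_derivative g (at x) v"]])
      (use Suc.prems in \<open>auto simp: frechet_derivative_add_at\<close>)
  then show ?case using Suc.prems by (simp add: differentiable_add)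
qed

lemma Ck_on_mult:
  fixes f g :: "'a::real_normed_vector \<Rightarrow> real"
  assumes "open S" "Ck_on k S f" "Ck_on k S g"
  shows "Ck_on k S (\<lambda>x. f x * g x)"
  using assms(2,3)
proof (induction k arbitrary: f g)
  case 0
  then show ?case by (simp add: continuous_on_mult)
next
  case (Suc k)
  have "Ck_on k S (\<lambda>x. frechet_derivative (\<lambda>x. f x * g x) (at x) v)" for v
  proof (rule Ck_on_cong[OF \<open>open S\<close>])
    \<comment> \<open>The undifferentiated factors are given at order \<open>Suc k\<close>;
      \<open>Ck_on_SucD\<close> lowers them to the order \<open>k\<close> at which the induction
      hypothesis handles products.\<close>
    show "Ck_on k S (\<lambda>x. f x * frechet_derivative g (at x) v + frechet_derivative f (at x) v * g x)"
      using Suc.prems Ck_on_SucD[OF Suc.prems(1)] Ck_on_SucD[OF Suc.prems(2)]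
      by (intro Ck_on_add[OF \<open>open S\<close>] Suc.IH) auto
  qed (use Suc.prems in \<open>auto simp: frechet_derivative_mult_at\<close>)
  then show ?case using Suc.prems by simp
qed

lemma smooth_fun_const: "smooth_fun A (\<lambda>x. c)"
  by (auto simp: smooth_fun_def smooth_on_def comp_def Ck_on_const)

lemma
  assumes "smooth_atlas A" "smooth_fun A f" "smooth_fun A h"
  shows smooth_fun_add: "smooth_fun A (\<lambda>x. f x + h x)"
    and smooth_fun_mult: "smooth_fun A (\<lambda>x. f x * h x)"
proof -
  have "open (\<kappa> ` U)" if "(U, \<kappa>) \<in> A" for U \<kappa>
    using assms(1) that by (auto simp: smooth_atlas_def)
  then show "smooth_fun A (\<lambda>x. f x + h x)" "smooth_fun A (\<lambda>x. f x * h x)"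
    using assms(2,3) by (auto simp: smooth_fun_def smooth_on_def comp_def intro!: Ck_on_add Ck_on_mult)
qed

lemma smooth_fun_cmult:
  "smooth_atlas A \<Longrightarrow> smooth_fun A f \<Longrightarrow> smooth_fun A (\<lambda>x. c * f x)"
  by (rule smooth_fun_mult[OF _ smooth_fun_const])

lemma smooth_fun_diff:
  assumes "smooth_atlas A" "smooth_fun A f" "smooth_fun A h"
  shows "smooth_fun A (\<lambda>x. f x - h x)"
  using smooth_fun_add[OF assms(1,2) smooth_fun_cmult[OF assms(1,3), of "-1"]] by simp

lemma smooth_fun_sum:
  assumes "smooth_atlas A" "\<And>i. i \<in> S \<Longrightarrow> smooth_fun A (f i)"
  shows "smooth_fun A (\<lambda>x. \<Sum>i\<in>S. f i x)"
  using assms(2)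
  by (induction S rule: infinite_finite_induct) (auto intro: smooth_fun_const smooth_fun_add[OF assms(1)])


section \<open>Derivations and the Lie bracket\<close>

lemma
  assumes "v \<in> tangent_space A p"
  shows tangent_add: "smooth_fun A f \<Longrightarrow> smooth_fun A h \<Longrightarrow> v (\<lambda>x. f x + h x) = v f + v h"
    and tangent_cmult: "smooth_fun A f \<Longrightarrow> v (\<lambda>x. c * f x) = c * v f"
    and tangent_mult: "smooth_fun A f \<Longrightarrow> smooth_fun A h \<Longrightarrow>
      v (\<lambda>x. f x * h x) = f p * v h + h p * v f"
    and tangent_nonsmooth: "\<not> smooth_fun A f \<Longrightarrow> v f = 0"
  using assms by (auto simp: tangent_space_def)

lemma tangent_const:
  assumes "v \<in> tangent_space A p"
  shows "v (\<lambda>x. c) = 0"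
proof -
  \<comment> \<open>The Leibniz rule for 1 = 1 * 1 reads v(1) = 2 v(1).\<close>
  have "v (\<lambda>x. 1) = 0"
    using tangent_mult[OF assms smooth_fun_const smooth_fun_const, of 1 1] by simp
  then show ?thesis
    using tangent_cmult[OF assms smooth_fun_const[of A 1], of c] by simp
qed

lemma tangent_diff:
  assumes "smooth_atlas A" "v \<in> tangent_space A p" "smooth_fun A f" "smooth_fun A h"
  shows "v (\<lambda>x. f x - h x) = v f - v h"
  using tangent_add[OF assms(2,3) smooth_fun_cmult[OF assms(1,4), of "-1"]]
    tangent_cmult[OF assms(2,4), of "-1"] by simp

lemma tangent_sum:
  assumes "smooth_atlas A" "v \<in> tangent_space A p" "\<And>i. i \<in> S \<Longrightarrow> smooth_fun A (f i)"
  shows "v (\<lambda>x. \<Sum>i\<in>S. f i x) = (\<Sum>i\<in>S. v (f i))"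
  using assms(3)
  by (induction S rule: infinite_finite_induct)
    (simp_all add: tangent_const[OF assms(2)] tangent_add[OF assms(2)] smooth_fun_sum[OF assms(1)])

lemma tangent_space_sum:
  assumes "\<And>i. i \<in> S \<Longrightarrow> v i \<in> tangent_space A p"
  shows "(\<lambda>f. \<Sum>i\<in>S. c i * v i f) \<in> tangent_space A p"
  using assms unfolding tangent_space_def
  by (simp add: sum.distrib[symmetric] sum_distrib_left algebra_simps)

lemma tangent_space_plus:
  "v \<in> tangent_space A p \<Longrightarrow> w \<in> tangent_space A p \<Longrightarrow> v \<oplus>\<^sub>t w \<in> tangent_space A p"
  by (auto simp: tangent_space_def tplus_def algebra_simps)

lemma tangent_space_scale:
  "v \<in> tangent_space A p \<Longrightarrow> c \<odot>\<^sub>t v \<in> tangent_space A p"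
  by (auto simp: tangent_space_def tscale_def algebra_simps)

lemma tangent_space_zero: "tzero \<in> tangent_space A p"
  by (auto simp: tangent_space_def tzero_def)

lemma vector_fieldD:
  "vector_field A X \<Longrightarrow> X p \<in> tangent_space A p"
  "vector_field A X \<Longrightarrow> smooth_fun A f \<Longrightarrow> smooth_fun A (\<lambda>p. X p f)"
  by (auto simp: vector_field_def)

lemma vector_field_sum:
  assumes "smooth_atlas A" "\<And>i. i \<in> S \<Longrightarrow> vector_field A (X i)" "\<And>i. i \<in> S \<Longrightarrow> smooth_fun A (c i)"
  shows "vector_field A (\<lambda>p f. \<Sum>i\<in>S. c i p * X i p f)"
  using assms unfolding vector_field_def
  by (auto intro!: tangent_space_sum smooth_fun_sum smooth_fun_mult)

lemma vector_field_scale: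
  assumes "smooth_atlas A" "vector_field A X" "smooth_fun A c"
  shows "vector_field A (\<lambda>p. c p \<odot>\<^sub>t X p)"
  using vector_field_sum[of A "{0::nat}" "\<lambda>_. X" "\<lambda>_. c"] assms by (simp add: tscale_def)

lemma vector_field_plus:
  assumes "smooth_atlas A" "vector_field A X" "vector_field A Y"
  shows "vector_field A (\<lambda>p. X p \<oplus>\<^sub>t Y p)"
  using assms by (auto simp: vector_field_def tangent_space_plus)
    (auto simp: tplus_def smooth_fun_add)

lemma lie_bracket_swap: "lie_bracket X Y p = (-1) \<odot>\<^sub>t lie_bracket Y X p"
  by (simp add: lie_bracket_def tscale_def)

lemma vector_field_lie_bracket:
  assumes A: "smooth_atlas A" and X: "vector_field A X" and Y: "vector_field A Y"
  shows "vector_field A (lie_bracket X Y)"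
proof -
  note S = vector_fieldD(2)[OF X] vector_fieldD(2)[OF Y] smooth_fun_add[OF A] smooth_fun_mult[OF A]
    smooth_fun_cmult[OF A]
  have "lie_bracket X Y p \<in> tangent_space A p" for p
  proof -
    note T = vector_fieldD(1)[OF X] vector_fieldD(1)[OF Y]
    note R = T[THEN tangent_add] T[THEN tangent_mult] T[THEN tangent_cmult] T[THEN tangent_const]
      T[THEN tangent_nonsmooth]
    \<comment> \<open>The second-order terms in the Leibniz rule are symmetric in \<open>X\<close>
      and \<open>Y\<close> and cancel. On a nonsmooth function both inner functions are constantly
      0, so the bracket respects the default value 0 as well.\<close>
    show ?thesis
      unfolding tangent_space_def lie_bracket_def
      by (auto simp: R S algebra_simps)
  qed
  then show ?thesis
    unfolding vector_field_def lie_bracket_def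
    using S smooth_fun_diff[OF A] by auto
qed

text \<open>On a smooth function all threefold derivatives cancel in pairs once the outer
  derivations are distributed over the differences. On a nonsmooth function each nested bracket is 0
  because it is again a vector field.\<close>

lemma lie_bracket_jacobi:
  assumes A: "smooth_atlas A" and X: "vector_field A X" and Y: "vector_field A Y" and Z: "vector_field A Z"
  shows "lie_bracket (lie_bracket X Y) Z p \<oplus>\<^sub>t lie_bracket (lie_bracket Y Z) X p
    \<oplus>\<^sub>t lie_bracket (lie_bracket Z X) Y p = tzero"
proof
  fix f
  note S = vector_fieldD(2)[OF X] vector_fieldD(2)[OF Y] vector_fieldD(2)[OF Z]
  note L = vector_field_lie_bracket[OF A]
  note T = vector_fieldD(1)[OF X, of p] vector_fieldD(1)[OF Y, of p] vector_fieldD(1)[OF Z, of p]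
  show "(lie_bracket (lie_bracket X Y) Z p \<oplus>\<^sub>t lie_bracket (lie_bracket Y Z) X p
    \<oplus>\<^sub>t lie_bracket (lie_bracket Z X) Y p) f = tzero f"
  proof (cases "smooth_fun A f")
    case True
    then show ?thesis
      by (simp add: tplus_def tzero_def lie_bracket_def T[THEN tangent_diff[OF A]] S)
  next
    case False
    then show ?thesis
      using L[OF L[OF X Y] Z] L[OF L[OF Y Z] X] L[OF L[OF Z X] Y]
      by (simp add: tplus_def tzero_def vector_fieldD(1)[THEN tangent_nonsmooth])
  qed
qed


section \<open>Frames\<close>

text \<open>Tangent vectors are bare functions and \<open>L\<close> is linear only on
  \<open>tangent_space A p\<close>, so linearity is iterated by induction, every partial sum staying
  in the tangent space.\<close>

lemma linear_on_tangent_sum: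
  assumes "\<And>v w. v \<in> tangent_space A p \<Longrightarrow> w \<in> tangent_space A p \<Longrightarrow> L (v \<oplus>\<^sub>t w) = L v + L w"
    and "\<And>c v. v \<in> tangent_space A p \<Longrightarrow> L (c \<odot>\<^sub>t v) = c * L v"
    and "\<And>i. i \<in> S \<Longrightarrow> v i \<in> tangent_space A p"
  shows "L (\<lambda>f. \<Sum>i\<in>S. c i * v i f) = (\<Sum>i\<in>S. c i * (L (v i) :: real))"
proof -
  have z: "L (\<lambda>f. 0) = 0"
    using assms(2)[OF tangent_space_zero, of 0] by (simp add: tscale_def)
  have "(\<lambda>f. c i * v i f + (\<Sum>i\<in>F. c i * v i f)) = (c i \<odot>\<^sub>t v i) \<oplus>\<^sub>t (\<lambda>f. \<Sum>i\<in>F. c i * v i f)" for i F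
    by (simp add: tplus_def tscale_def)
  then show ?thesis
    using assms(3)
    by (induction S rule: infinite_finite_induct)
      (simp_all add: z assms(1,2) tangent_space_sum tangent_space_scale)
qed

lemma one_formD:
  assumes "one_form A \<alpha>"
  shows "v \<in> tangent_space A p \<Longrightarrow> w \<in> tangent_space A p \<Longrightarrow> \<alpha> p (v \<oplus>\<^sub>t w) = \<alpha> p v + \<alpha> p w"
    and "v \<in> tangent_space A p \<Longrightarrow> \<alpha> p (c \<odot>\<^sub>t v) = c * \<alpha> p v"
    and "vector_field A X \<Longrightarrow> smooth_fun A (\<lambda>p. \<alpha> p (X p))"
  using assms unfolding one_form_def by blast+

lemma bilinear_fieldD:
  assumes "bilinear_field A B"
  shows "u \<in> tangent_space A p \<Longrightarrow> v \<in> tangent_space A p \<Longrightarrow> w \<in> tangent_space A p \<Longrightarrow>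
      B p (u \<oplus>\<^sub>t v) w = B p u w + B p v w"
    and "u \<in> tangent_space A p \<Longrightarrow> w \<in> tangent_space A p \<Longrightarrow> B p (c \<odot>\<^sub>t u) w = c * B p u w"
    and "u \<in> tangent_space A p \<Longrightarrow> v \<in> tangent_space A p \<Longrightarrow> w \<in> tangent_space A p \<Longrightarrow>
      B p w (u \<oplus>\<^sub>t v) = B p w u + B p w v"
    and "u \<in> tangent_space A p \<Longrightarrow> w \<in> tangent_space A p \<Longrightarrow> B p w (c \<odot>\<^sub>t u) = c * B p w u"
    and "vector_field A X \<Longrightarrow> vector_field A Y \<Longrightarrow> smooth_fun A (\<lambda>p. B p (X p) (Y p))"
  using assms unfolding bilinear_field_def by blast+

text \<open>Arbitrary nonzero \<open>h i\<close> cover both signatures at once. They are constants,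
  not functions on the manifold, so differentiating a metric expression only differentiates the
  components of its arguments.\<close>

locale orthogonal_frame =
  fixes A :: "('m::{t2_space,second_countable_topology}, 'e::euclidean_space) atlas"
    and e :: "3 \<Rightarrow> 'm vfield"
    and g :: "'m \<Rightarrow> 'm tvec \<Rightarrow> 'm tvec \<Rightarrow> real"
    and h :: "3 \<Rightarrow> real"
  assumes atlas: "smooth_atlas A"
    and frame: "frame A e"
    and bilinear: "bilinear_field A g"
    and metric_frame: "g p (e i p) (e j p) = (if i = j then h i else 0)"
    and h_nonzero: "h i \<noteq> 0"
begin

lemma frame_vector_field: "vector_field A (e i)"
  using frame by (simp add: frame_def)

lemma frame_tangent: "e i p \<in> tangent_space A p"
  by (rule vector_fieldD(1)[OF frame_vector_field])

lemma frame_ex1: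
  "v \<in> tangent_space A p \<Longrightarrow> \<exists>!c::real^3. v = (\<lambda>f. \<Sum>i\<in>UNIV. c $ i * e i p f)"
  using frame by (simp add: frame_def)

lemma coframe_expand:
  "v \<in> tangent_space A p \<Longrightarrow> v = (\<lambda>f. \<Sum>i\<in>UNIV. coframe e p v $ i * e i p f)"
  unfolding coframe_def by (rule theI'[OF frame_ex1])

lemma coframe_lincomb: "coframe e p (\<lambda>f. \<Sum>i\<in>UNIV. c i * e i p f) = (\<chi> i. c i)"
proof -
  have "(\<lambda>f. \<Sum>i\<in>UNIV. c i * e i p f) \<in> tangent_space A p"
    by (intro tangent_space_sum frame_tangent)
  from frame_ex1[OF this] show ?thesis
    unfolding coframe_def by (rule the1_equality) simp
qed

lemma coframe_frame: "coframe e p (e i p) $ j = (if i = j then 1 else 0)"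
proof -
  have "e i p = (\<lambda>f. \<Sum>j\<in>UNIV. (if i = j then 1 else 0) * e j p f)"
    by (simp add: if_distrib[of "\<lambda>x. x * _"] cong: if_cong)
  then have "coframe e p (e i p) = coframe e p (\<lambda>f. \<Sum>j\<in>UNIV. (if i = j then 1 else 0) * e j p f)"
    by simp
  then show ?thesis by (simp only: coframe_lincomb) simp
qed

lemma
  assumes "v \<in> tangent_space A p"
  shows coframe_plus: "w \<in> tangent_space A p \<Longrightarrow> coframe e p (v \<oplus>\<^sub>t w) = coframe e p v + coframe e p w"
    and coframe_scale: "coframe e p (c \<odot>\<^sub>t v) = c *\<^sub>R coframe e p v"
proof -
  have "c \<odot>\<^sub>t v = (\<lambda>f. \<Sum>i\<in>UNIV. (c * coframe e p v $ i) * e i p f)"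
    by (subst (1) coframe_expand[OF assms]) (simp add: tscale_def sum_distrib_left mult.assoc)
  then show "coframe e p (c \<odot>\<^sub>t v) = c *\<^sub>R coframe e p v"
    by (simp add: coframe_lincomb vec_eq_iff)
  assume w: "w \<in> tangent_space A p"
  have "v \<oplus>\<^sub>t w = (\<lambda>f. \<Sum>i\<in>UNIV. (coframe e p v $ i + coframe e p w $ i) * e i p f)"
    by (subst (1) coframe_expand[OF assms], subst (1) coframe_expand[OF w])
      (simp add: tplus_def sum.distrib algebra_simps)
  then show "coframe e p (v \<oplus>\<^sub>t w) = coframe e p v + coframe e p w"
    by (simp add: coframe_lincomb vec_eq_iff)
qed

lemma tangent_eq_iff_coframe:
  assumes "v \<in> tangent_space A p" "w \<in> tangent_space A p"
  shows "v = w \<longleftrightarrow> coframe e p v = coframe e p w"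
  using coframe_expand[OF assms(1)] coframe_expand[OF assms(2)] by metis

lemma metric_coframe:
  assumes v: "v \<in> tangent_space A p" and w: "w \<in> tangent_space A p"
  shows "g p v w = (\<Sum>i\<in>UNIV. h i * coframe e p v $ i * coframe e p w $ i)"
proof -
  note B = bilinear_fieldD(1-4)[OF bilinear]
  have "g p u w = (\<Sum>i\<in>UNIV. coframe e p w $ i * g p u (e i p))" if u: "u \<in> tangent_space A p" for u
    by (subst (1) coframe_expand[OF w], rule linear_on_tangent_sum[of A p "g p u"])
      (auto simp: B u frame_tangent)
  moreover have "g p v u = (\<Sum>i\<in>UNIV. coframe e p v $ i * g p (e i p) u)"
    if u: "u \<in> tangent_space A p" for u
    by (subst (1) coframe_expand[OF v], rule linear_on_tangent_sum[of A p "\<lambda>v. g p v u"])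
      (auto simp: B u frame_tangent)
  ultimately show ?thesis
    by (simp add: v w frame_tangent metric_frame sum_3 algebra_simps)
qed

lemma metric_frame_right:
  "v \<in> tangent_space A p \<Longrightarrow> g p v (e i p) = h i * coframe e p v $ i"
  by (simp add: metric_coframe frame_tangent coframe_frame sum.delta' if_distrib cong: if_cong)

text \<open>A frame provides coefficients only pointwise. Smooth dependence comes from the metric,
  which gives the \<open>i\<close>-th coefficient as g(X, e_i) / h_i.\<close>

lemma smooth_coframe:
  assumes "vector_field A X"
  shows "smooth_fun A (\<lambda>p. coframe e p (X p) $ i)"
proof -
  have "smooth_fun A (\<lambda>p. inverse (h i) * g p (X p) (e i p))"
    by (intro smooth_fun_cmult atlas bilinear_fieldD(5)[OF bilinear] assms frame_vector_field)
  then show ?thesis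
    using h_nonzero[of i]
    by (simp add: metric_frame_right vector_fieldD(1)[OF assms] mult.assoc[symmetric])
qed

lemma vector_field_expand:
  "vector_field A X \<Longrightarrow> X p f = (\<Sum>i\<in>UNIV. coframe e p (X p) $ i * e i p f)"
  using coframe_expand[OF vector_fieldD(1)] by metis

lemma one_form_coframe:
  assumes "one_form A \<alpha>" "v \<in> tangent_space A p"
  shows "\<alpha> p v = (\<Sum>i\<in>UNIV. coframe e p v $ i * \<alpha> p (e i p))"
  by (subst (1) coframe_expand[OF assms(2)], rule linear_on_tangent_sum[of A p "\<alpha> p"])
    (auto simp: one_formD[OF assms(1)] frame_tangent)

text \<open>The Leibniz rule is applied to the components of the inner field; the remaining terms
  e_i(e_j f) pair up to brackets of frame fields. On nonsmooth functions both sides are 0.\<close>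

lemma lie_bracket_expand:
  assumes X: "vector_field A X" and Y: "vector_field A Y"
  shows "lie_bracket X Y p = (\<lambda>f. (\<Sum>j\<in>UNIV. X p (\<lambda>q. coframe e q (Y q) $ j) * e j p f)
     - (\<Sum>j\<in>UNIV. Y p (\<lambda>q. coframe e q (X q) $ j) * e j p f)
     + (\<Sum>i\<in>UNIV. \<Sum>j\<in>UNIV. coframe e p (X p) $ i * coframe e p (Y p) $ j * lie_bracket (e i) (e j) p f))"
proof
  fix f
  show "lie_bracket X Y p f = (\<Sum>j\<in>UNIV. X p (\<lambda>q. coframe e q (Y q) $ j) * e j p f)
     - (\<Sum>j\<in>UNIV. Y p (\<lambda>q. coframe e q (X q) $ j) * e j p f)
     + (\<Sum>i\<in>UNIV. \<Sum>j\<in>UNIV. coframe e p (X p) $ i * coframe e p (Y p) $ j * lie_bracket (e i) (e j) p f)"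
  proof (cases "smooth_fun A f")
    case True
    have S: "smooth_fun A (\<lambda>q. e i q f)" for i
      by (rule vector_fieldD(2)[OF frame_vector_field True])
    have "Z p (\<lambda>q. W q f) = (\<Sum>j\<in>UNIV. Z p (\<lambda>q. coframe e q (W q) $ j) * e j p f)
      + (\<Sum>i\<in>UNIV. \<Sum>j\<in>UNIV. coframe e p (Z p) $ i * coframe e p (W p) $ j * e i p (\<lambda>q. e j q f))"
      if Z: "vector_field A Z" and W: "vector_field A W" for Z W
    proof -
      note T = vector_fieldD(1)[OF Z, of p]
      have "Z p (\<lambda>q. W q f) = Z p (\<lambda>q. \<Sum>j\<in>UNIV. coframe e q (W q) $ j * e j q f)"
        by (simp only: vector_field_expand[OF W])
      also have "\<dots> = (\<Sum>j\<in>UNIV. Z p (\<lambda>q. coframe e q (W q) $ j * e j q f))"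
        by (rule tangent_sum[OF atlas T]) (intro smooth_fun_mult atlas smooth_coframe W S)
      also have "\<dots> = (\<Sum>j\<in>UNIV. coframe e p (W p) $ j * Z p (\<lambda>q. e j q f) +
          e j p f * Z p (\<lambda>q. coframe e q (W q) $ j))"
        by (simp add: tangent_mult[OF T] smooth_coframe[OF W] S)
      also have "\<dots> = (\<Sum>j\<in>UNIV. coframe e p (W p) $ j *
          (\<Sum>i\<in>UNIV. coframe e p (Z p) $ i * e i p (\<lambda>q. e j q f)) + e j p f * Z p (\<lambda>q. coframe e q (W q) $ j))"
        by (simp only: vector_field_expand[OF Z, of p "\<lambda>q. e _ q f"])
      finally show ?thesis by (simp add: sum_3 algebra_simps)
    qed
    from this[OF X Y] this[OF Y X] show ?thesis
      by (simp add: lie_bracket_def sum_3 algebra_simps)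
  next
    case False
    note N = tangent_nonsmooth[OF vector_fieldD(1)[OF vector_field_lie_bracket[OF atlas]] False]
    show ?thesis
      by (simp add: N[OF X Y] N[OF frame_vector_field frame_vector_field]
          tangent_nonsmooth[OF frame_tangent False])
  qed
qed

lemma one_form_lie_bracket:
  assumes \<alpha>: "one_form A \<alpha>" and X: "vector_field A X" and Y: "vector_field A Y"
  shows "\<alpha> p (lie_bracket X Y p) = (\<Sum>j\<in>UNIV. X p (\<lambda>q. coframe e q (Y q) $ j) * \<alpha> p (e j p))
     - (\<Sum>j\<in>UNIV. Y p (\<lambda>q. coframe e q (X q) $ j) * \<alpha> p (e j p))
     + (\<Sum>i\<in>UNIV. \<Sum>j\<in>UNIV. coframe e p (X p) $ i * coframe e p (Y p) $ j * \<alpha> p (lie_bracket (e i) (e j) p))"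
proof -
  define c where "c j = X p (\<lambda>q. coframe e q (Y q) $ j) - Y p (\<lambda>q. coframe e q (X q) $ j)" for j
  define d where "d = (\<lambda>(i, j). coframe e p (X p) $ i * coframe e p (Y p) $ j)"
  note L = vector_fieldD(1)[OF vector_field_lie_bracket[OF atlas frame_vector_field frame_vector_field]]
  let ?u = "\<lambda>f. \<Sum>j\<in>UNIV. c j * e j p f"
  let ?w = "\<lambda>f. \<Sum>ij\<in>UNIV. d ij * lie_bracket (e (fst ij)) (e (snd ij)) p f"
  \<comment> \<open>\<open>linear_on_tangent_sum\<close> deals with one index set, so the double sum
    becomes a sum over pairs.\<close>
  have pair: "(\<Sum>i\<in>UNIV. \<Sum>j\<in>UNIV. F i j) = (\<Sum>ij\<in>UNIV. F (fst ij) (snd ij))"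
    for F :: "3 \<Rightarrow> 3 \<Rightarrow> real"
    by (simp add: sum.cartesian_product case_prod_beta)
  have T: "?u \<in> tangent_space A p" "?w \<in> tangent_space A p"
    by (intro tangent_space_sum frame_tangent L)+
  have "lie_bracket X Y p = ?u \<oplus>\<^sub>t ?w"
    unfolding lie_bracket_expand[OF X Y] tplus_def c_def d_def pair
    by (simp add: sum_subtractf left_diff_distrib case_prod_beta)
  then have "\<alpha> p (lie_bracket X Y p) = \<alpha> p ?u + \<alpha> p ?w"
    using one_formD(1)[OF \<alpha> T] by simp
  also have "\<alpha> p ?u = (\<Sum>j\<in>UNIV. c j * \<alpha> p (e j p))"
    by (rule linear_on_tangent_sum[of A p "\<alpha> p"]) (auto simp: one_formD[OF \<alpha>] frame_tangent)
  also have "\<alpha> p ?w = (\<Sum>ij\<in>UNIV. d ij * \<alpha> p (lie_bracket (e (fst ij)) (e (snd ij)) p))"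
    by (rule linear_on_tangent_sum[of A p "\<alpha> p"]) (auto simp: one_formD[OF \<alpha>] L)
  finally show ?thesis
    unfolding c_def d_def pair by (simp add: sum_subtractf left_diff_distrib case_prod_beta)
qed

end


section \<open>Exterior derivative, index raising and the Levi-Civita connection in a frame\<close>

lemma levi_civitaD:
  assumes "levi_civita A g D"
  shows "vector_field A X \<Longrightarrow> vector_field A Y \<Longrightarrow> vector_field A (D X Y)"
    and "vector_field A X \<Longrightarrow> vector_field A X' \<Longrightarrow> vector_field A Y \<Longrightarrow>
        D (\<lambda>p. X p \<oplus>\<^sub>t X' p) Y = (\<lambda>p. D X Y p \<oplus>\<^sub>t D X' Y p)"
    and "smooth_fun A f \<Longrightarrow> vector_field A X \<Longrightarrow> vector_field A Y \<Longrightarrow>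
        D (\<lambda>p. f p \<odot>\<^sub>t X p) Y = (\<lambda>p. f p \<odot>\<^sub>t D X Y p)"
    and "vector_field A X \<Longrightarrow> vector_field A Y \<Longrightarrow> vector_field A Y' \<Longrightarrow>
        D X (\<lambda>p. Y p \<oplus>\<^sub>t Y' p) = (\<lambda>p. D X Y p \<oplus>\<^sub>t D X Y' p)"
    and "smooth_fun A f \<Longrightarrow> vector_field A X \<Longrightarrow> vector_field A Y \<Longrightarrow>
        D X (\<lambda>p. f p \<odot>\<^sub>t Y p) = (\<lambda>p. X p f \<odot>\<^sub>t Y p \<oplus>\<^sub>t f p \<odot>\<^sub>t D X Y p)"
    and "vector_field A X \<Longrightarrow> vector_field A Y \<Longrightarrow>
        D X Y p \<oplus>\<^sub>t (-1) \<odot>\<^sub>t D Y X p = lie_bracket X Y p"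
    and "vector_field A X \<Longrightarrow> vector_field A Y \<Longrightarrow> vector_field A Z \<Longrightarrow>
        X p (\<lambda>q. g q (Y q) (Z q)) = g p (D X Y p) (Z p) + g p (Y p) (D X Z p)"
  using assms by (simp_all add: levi_civita_def)

context orthogonal_frame
begin

lemma vector_field_lincomb: "vector_field A (\<lambda>p f. \<Sum>i\<in>UNIV. c i * e i p f)"
  by (rule vector_field_sum[OF atlas]) (auto simp: frame_vector_field smooth_fun_const)

text \<open>The extension keeps the coefficients of \<open>v\<close> constant along the global
  frame.\<close>

lemma vector_field_extension:
  assumes "v \<in> tangent_space A p"
  obtains X where "vector_field A X" "X p = v"
  using that[OF vector_field_lincomb] coframe_expand[OF assms] by metis

text \<open>The derivatives of the components of \<open>X\<close> and \<open>Y\<close> cancel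
  against those contained in \<alpha>([X, Y]). The right-hand side involves only \<open>X p\<close>
  and \<open>Y p\<close>, which makes the definite description in \<open>ext_deriv1\<close> well
  defined.\<close>

lemma ext_deriv1_tensorial:
  assumes \<alpha>: "one_form A \<alpha>" and X: "vector_field A X" and Y: "vector_field A Y"
  shows "X p (\<lambda>q. \<alpha> q (Y q)) - Y p (\<lambda>q. \<alpha> q (X q)) - \<alpha> p (lie_bracket X Y p) =
    (\<Sum>i\<in>UNIV. \<Sum>j\<in>UNIV. coframe e p (X p) $ i * coframe e p (Y p) $ j *
      (e i p (\<lambda>q. \<alpha> q (e j q)) - e j p (\<lambda>q. \<alpha> q (e i q)) - \<alpha> p (lie_bracket (e i) (e j) p)))"
proof -
  have S: "smooth_fun A (\<lambda>q. \<alpha> q (e j q))" for j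
    by (rule one_formD(3)[OF \<alpha> frame_vector_field])
  have "Z p (\<lambda>q. \<alpha> q (W q)) = (\<Sum>j\<in>UNIV. Z p (\<lambda>q. coframe e q (W q) $ j) * \<alpha> p (e j p))
    + (\<Sum>i\<in>UNIV. \<Sum>j\<in>UNIV. coframe e p (Z p) $ i * coframe e p (W p) $ j * e i p (\<lambda>q. \<alpha> q (e j q)))"
    if Z: "vector_field A Z" and W: "vector_field A W" for Z W
  proof -
    note T = vector_fieldD(1)[OF Z, of p]
    have "Z p (\<lambda>q. \<alpha> q (W q)) = Z p (\<lambda>q. \<Sum>j\<in>UNIV. coframe e q (W q) $ j * \<alpha> q (e j q))"
      by (simp only: one_form_coframe[OF \<alpha> vector_fieldD(1)[OF W]])
    also have "\<dots> = (\<Sum>j\<in>UNIV. Z p (\<lambda>q. coframe e q (W q) $ j * \<alpha> q (e j q)))"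
      by (rule tangent_sum[OF atlas T]) (intro smooth_fun_mult atlas smooth_coframe W S)
    also have "\<dots> = (\<Sum>j\<in>UNIV. coframe e p (W p) $ j * Z p (\<lambda>q. \<alpha> q (e j q)) +
        \<alpha> p (e j p) * Z p (\<lambda>q. coframe e q (W q) $ j))"
      by (simp add: tangent_mult[OF T] smooth_coframe[OF W] S)
    also have "\<dots> = (\<Sum>j\<in>UNIV. coframe e p (W p) $ j *
        (\<Sum>i\<in>UNIV. coframe e p (Z p) $ i * e i p (\<lambda>q. \<alpha> q (e j q))) +
        \<alpha> p (e j p) * Z p (\<lambda>q. coframe e q (W q) $ j))"
      by (simp only: vector_field_expand[OF Z, of p "\<lambda>q. \<alpha> q (e _ q)"])
    finally show ?thesis by (simp add: sum_3 algebra_simps)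
  qed
  from this[OF X Y] this[OF Y X] one_form_lie_bracket[OF \<alpha> X Y, of p] show ?thesis
    by (simp add: sum_3 algebra_simps)
qed

lemma ext_deriv1_vector_fields:
  assumes \<alpha>: "one_form A \<alpha>" and X: "vector_field A X" and Y: "vector_field A Y"
  shows "ext_deriv1 A \<alpha> p (X p) (Y p) =
    X p (\<lambda>q. \<alpha> q (Y q)) - Y p (\<lambda>q. \<alpha> q (X q)) - \<alpha> p (lie_bracket X Y p)"
  unfolding ext_deriv1_def
proof (rule the_equality)
  fix c
  assume "\<exists>X' Y'. vector_field A X' \<and> vector_field A Y' \<and> X' p = X p \<and> Y' p = Y p \<and>
     c = X' p (\<lambda>q. \<alpha> q (Y' q)) - Y' p (\<lambda>q. \<alpha> q (X' q)) - \<alpha> p (lie_bracket X' Y' p)"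
  then obtain X' Y' where *: "vector_field A X'" "vector_field A Y'" "X' p = X p" "Y' p = Y p"
    and c: "c = X' p (\<lambda>q. \<alpha> q (Y' q)) - Y' p (\<lambda>q. \<alpha> q (X' q)) - \<alpha> p (lie_bracket X' Y' p)"
    by auto
  show "c = X p (\<lambda>q. \<alpha> q (Y q)) - Y p (\<lambda>q. \<alpha> q (X q)) - \<alpha> p (lie_bracket X Y p)"
    using ext_deriv1_tensorial[OF \<alpha> *(1,2), of p] ext_deriv1_tensorial[OF \<alpha> X Y, of p]
    unfolding c *(3,4) by (simp only:)
qed (use X Y in blast)

lemma ext_deriv1_coframe:
  assumes \<alpha>: "one_form A \<alpha>" and v: "v \<in> tangent_space A p" and w: "w \<in> tangent_space A p"
  shows "ext_deriv1 A \<alpha> p v w = (\<Sum>i\<in>UNIV. \<Sum>j\<in>UNIV. coframe e p v $ i * coframe e p w $ j *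
      (e i p (\<lambda>q. \<alpha> q (e j q)) - e j p (\<lambda>q. \<alpha> q (e i q)) - \<alpha> p (lie_bracket (e i) (e j) p)))"
proof -
  obtain X where X: "vector_field A X" "X p = v" by (rule vector_field_extension[OF v])
  obtain Y where Y: "vector_field A Y" "Y p = w" by (rule vector_field_extension[OF w])
  show ?thesis
    using ext_deriv1_vector_fields[OF \<alpha> X(1) Y(1), of p]
      ext_deriv1_tensorial[OF \<alpha> X(1) Y(1), of p] X(2) Y(2) by simp
qed

lemma closed_ext_deriv1:
  assumes \<alpha>: "one_form A \<alpha>"
  shows "closed_two_form A (ext_deriv1 A \<alpha>)"
proof -
  note LB = vector_field_lie_bracket[OF atlas]
  note E = ext_deriv1_vector_fields[OF \<alpha>]
  have z: "\<alpha> p tzero = 0" for p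
    using one_formD(2)[OF \<alpha> tangent_space_zero, of p 0] by (simp add: tscale_def tzero_def)
  have S: "smooth_fun A (\<lambda>p. X p (\<lambda>q. \<alpha> q (Y q)))" "smooth_fun A (\<lambda>p. \<alpha> p (lie_bracket X Y p))"
    if "vector_field A X" "vector_field A Y" for X Y
    using vector_fieldD(2)[OF that(1) one_formD(3)[OF \<alpha> that(2)]]
      one_formD(3)[OF \<alpha> LB[OF that]] by simp_all
  have "smooth_fun A (\<lambda>p. ext_deriv1 A \<alpha> p (X p) (Y p))" if "vector_field A X" "vector_field A Y" for X Y
    unfolding E[OF that]
    by (intro smooth_fun_diff[OF atlas] S[OF that] S(1)[OF that(2,1)])
  then have "bilinear_field A (ext_deriv1 A \<alpha>)"
    unfolding bilinear_field_def
    by (simp add: ext_deriv1_coframe[OF \<alpha>] coframe_plus coframe_scale tangent_space_plus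
        tangent_space_scale distrib_left distrib_right sum.distrib sum_distrib_left
        mult.assoc mult.left_commute)
  moreover have "ext_deriv1 A \<alpha> p v v = 0" if v: "v \<in> tangent_space A p" for p v
  proof -
    obtain X where X: "vector_field A X" "X p = v" by (rule vector_field_extension[OF v])
    have "lie_bracket X X p = tzero"
      by (simp add: lie_bracket_def tzero_def)
    then show ?thesis
      using E[OF X(1) X(1), of p] X(2) z by simp
  qed
  moreover have "X p (\<lambda>q. ext_deriv1 A \<alpha> q (Y q) (Z q)) + Y p (\<lambda>q. ext_deriv1 A \<alpha> q (Z q) (X q)) +
      Z p (\<lambda>q. ext_deriv1 A \<alpha> q (X q) (Y q)) - ext_deriv1 A \<alpha> p (lie_bracket X Y p) (Z p)
      - ext_deriv1 A \<alpha> p (lie_bracket Y Z p) (X p) - ext_deriv1 A \<alpha> p (lie_bracket Z X p) (Y p) = 0"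
    if X: "vector_field A X" and Y: "vector_field A Y" and Z: "vector_field A Z" for X Y Z p
  proof -
    let ?u = "lie_bracket (lie_bracket X Y) Z p" and ?v = "lie_bracket (lie_bracket Y Z) X p"
      and ?w = "lie_bracket (lie_bracket Z X) Y p"
    have T: "?u \<in> tangent_space A p" "?v \<in> tangent_space A p" "?w \<in> tangent_space A p"
      by (intro vector_fieldD(1) LB X Y Z)+
    \<comment> \<open>Expanding everything by the definition of the exterior derivative and of the
      bracket cancels all terms except \<alpha> on the nested brackets; the Jacobi identity disposes
      of these.\<close>
    have J: "\<alpha> p ?u + \<alpha> p ?v + \<alpha> p ?w = 0"
      using lie_bracket_jacobi[OF atlas X Y Z, of p] T
      by (metis one_formD(1)[OF \<alpha>] tangent_space_plus z)
    note TX = vector_fieldD(1)[OF X, of p] vector_fieldD(1)[OF Y, of p] vector_fieldD(1)[OF Z, of p]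
    have D: "v (\<lambda>q. ext_deriv1 A \<alpha> q (Y q) (Z q)) =
        v (\<lambda>q. Y q (\<lambda>q. \<alpha> q (Z q))) - v (\<lambda>q. Z q (\<lambda>q. \<alpha> q (Y q))) - v (\<lambda>q. \<alpha> q (lie_bracket Y Z q))"
      if Y: "vector_field A Y" and Z: "vector_field A Z" and v: "v \<in> tangent_space A p" for Y Z v
      using tangent_diff[OF atlas v S(1)[OF Y Z] S(1)[OF Z Y]]
        tangent_diff[OF atlas v smooth_fun_diff[OF atlas S(1)[OF Y Z] S(1)[OF Z Y]] S(2)[OF Y Z]]
      by (simp add: E[OF Y Z])
    have L: "lie_bracket X Y p f = X p (\<lambda>q. Y q f) - Y p (\<lambda>q. X q f)" for X Y f
      by (simp add: lie_bracket_def)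
    show ?thesis
      using J
      by (simp add: D[OF X Y TX(3)] D[OF Y Z TX(1)] D[OF Z X TX(2)] E[OF LB[OF X Y] Z] E[OF LB[OF Y Z] X]
          E[OF LB[OF Z X] Y] L[of X Y] L[of Y Z] L[of Z X])
  qed
  ultimately show ?thesis
    by (simp add: closed_two_form_def two_form_def)
qed

text \<open>The vector with components \<alpha>(e_i) / h_i represents \<alpha>, and testing against
  the frame forces uniqueness. Linearity at the single point \<open>p\<close> is assumed, as this is
  what the contraction of a two-form with a vector offers.\<close>

lemma
  assumes "\<And>v w. v \<in> tangent_space A p \<Longrightarrow> w \<in> tangent_space A p \<Longrightarrow> \<alpha> (v \<oplus>\<^sub>t w) = \<alpha> v + \<alpha> w"
    and "\<And>c v. v \<in> tangent_space A p \<Longrightarrow> \<alpha> (c \<odot>\<^sub>t v) = c * \<alpha> v"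
  shows sharp_tangent: "sharp A g p \<alpha> \<in> tangent_space A p"
    and coframe_sharp: "coframe e p (sharp A g p \<alpha>) $ k = \<alpha> (e k p) / h k"
proof -
  define s where "s = (\<lambda>f. \<Sum>i\<in>UNIV. (\<alpha> (e i p) / h i) * e i p f)"
  have s: "s \<in> tangent_space A p"
    unfolding s_def by (intro tangent_space_sum frame_tangent)
  have cs: "coframe e p s $ k = \<alpha> (e k p) / h k" for k
    unfolding s_def coframe_lincomb by simp
  have "sharp A g p \<alpha> = s"
    unfolding sharp_def
  proof (rule the_equality)
    have "g p s w = \<alpha> w" if w: "w \<in> tangent_space A p" for w
    proof -
      have "\<alpha> w = (\<Sum>i\<in>UNIV. coframe e p w $ i * \<alpha> (e i p))"
        by (subst (1) coframe_expand[OF w], rule linear_on_tangent_sum[of A p \<alpha>])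
          (auto simp: assms frame_tangent)
      then show ?thesis
        by (simp add: metric_coframe[OF s w] cs h_nonzero mult.commute)
    qed
    then show "s \<in> tangent_space A p \<and> (\<forall>w\<in>tangent_space A p. g p s w = \<alpha> w)"
      using s by blast
    fix v assume v: "v \<in> tangent_space A p \<and> (\<forall>w\<in>tangent_space A p. g p v w = \<alpha> w)"
    then have "coframe e p v $ i = coframe e p s $ i" for i
      using metric_frame_right[of v p i] frame_tangent[of i p] h_nonzero[of i] by (simp add: cs)
    then show "v = s"
      using v s by (simp add: tangent_eq_iff_coframe[of v p s] vec_eq_iff)
  qed
  with s cs show "sharp A g p \<alpha> \<in> tangent_space A p"
    "coframe e p (sharp A g p \<alpha>) $ k = \<alpha> (e k p) / h k" by simp_all
qed

text \<open>By metric compatibility and vanishing torsion,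
  \<open>g(D\<^sub>X X, Z) = X(g(X, Z)) - Z(g(X, X))/2 - g(X, [X, Z])\<close>; for \<open>Z\<close> in the frame the derivatives
  of the components of \<open>X\<close> in direction \<open>Z\<close> cancel.\<close>

lemma levi_civita_self:
  assumes D: "levi_civita A g D" and X: "vector_field A X"
  shows "h k * coframe e p (D X X p) $ k = h k * X p (\<lambda>q. coframe e q (X q) $ k)
    - (\<Sum>i\<in>UNIV. coframe e p (X p) $ i * g p (X p) (lie_bracket (e i) (e k) p))"
proof -
  note LC = levi_civitaD[OF D]
  note F = frame_vector_field[of k]
  note T = vector_fieldD(1)[OF X] vector_fieldD(1)[OF F, of p]
    vector_fieldD(1)[OF LC(1)[OF X X], of p] vector_fieldD(1)[OF LC(1)[OF F X], of p]
    vector_fieldD(1)[OF LC(1)[OF X F], of p]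
  note Tp = T(1)[of p]
  let ?x = "\<lambda>q j. coframe e q (X q) $ j"
  have \<alpha>: "one_form A (\<lambda>q. g q (X q))"
    unfolding one_form_def
    using bilinear_fieldD(3)[OF bilinear _ _ T(1)] bilinear_fieldD(4)[OF bilinear _ T(1)]
      bilinear_fieldD(5)[OF bilinear X] by simp
  have S: "smooth_fun A (\<lambda>q. ?x q j)" for j
    by (rule smooth_coframe[OF X])
  have "e k p (\<lambda>q. g q (X q) (X q)) = e k p (\<lambda>q. \<Sum>j\<in>UNIV. h j * (?x q j * ?x q j))"
    by (simp add: metric_coframe T mult.assoc)
  also have "\<dots> = (\<Sum>j\<in>UNIV. e k p (\<lambda>q. h j * (?x q j * ?x q j)))"
    by (rule tangent_sum[OF atlas T(2)]) (intro smooth_fun_cmult smooth_fun_mult atlas S)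
  also have "\<dots> = (\<Sum>j\<in>UNIV. 2 * (h j * ?x p j * e k p (\<lambda>q. ?x q j)))"
    by (simp add: tangent_cmult[OF T(2)] tangent_mult[OF T(2)] smooth_fun_mult[OF atlas] S algebra_simps)
  finally have 1: "2 * (\<Sum>j\<in>UNIV. h j * ?x p j * e k p (\<lambda>q. ?x q j)) =
      g p (D (e k) X p) (X p) + g p (X p) (D (e k) X p)"
    by (simp add: LC(7)[OF F X X] sum_distrib_left)
  have "g p (D (e k) X p) (X p) = g p (X p) (D (e k) X p)"
    by (simp add: metric_coframe T mult.commute mult.left_commute)
  with 1 have 2: "g p (X p) (D (e k) X p) = (\<Sum>j\<in>UNIV. h j * ?x p j * e k p (\<lambda>q. ?x q j))"
    by simp
  have "X p (\<lambda>q. h k * ?x q k) = X p (\<lambda>q. g q (X q) (e k q))"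
    by (simp add: metric_frame_right T)
  then have 3: "h k * X p (\<lambda>q. ?x q k) = g p (D X X p) (e k p) + g p (X p) (D X (e k) p)"
    by (simp add: LC(7)[OF X X F] tangent_cmult[OF Tp S])
  have "g p (X p) (lie_bracket X (e k) p) = g p (X p) (D X (e k) p \<oplus>\<^sub>t (-1) \<odot>\<^sub>t D (e k) X p)"
    by (simp add: LC(6)[OF X F])
  also have "\<dots> = g p (X p) (D X (e k) p) - g p (X p) (D (e k) X p)"
    using bilinear_fieldD(3,4)[OF bilinear] T by (simp add: tangent_space_scale)
  finally have 4: "g p (X p) (D X (e k) p) = g p (X p) (lie_bracket X (e k) p) + g p (X p) (D (e k) X p)"
    by simp
  \<comment> \<open>The components of \<open>e k\<close> are constant, so the only derivatives left
    are those of the components of \<open>X\<close> along \<open>e k\<close>; they cancel against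
    fact \<open>2\<close> when substituted into fact \<open>4\<close>.\<close>
  have 5: "g p (X p) (lie_bracket X (e k) p) = - (\<Sum>j\<in>UNIV. e k p (\<lambda>q. ?x q j) * (h j * ?x p j))
     + (\<Sum>i\<in>UNIV. ?x p i * g p (X p) (lie_bracket (e i) (e k) p))"
    by (simp add: one_form_lie_bracket[OF \<alpha> X F] coframe_frame tangent_const[OF Tp]
        metric_frame_right[OF Tp] if_distrib[of "\<lambda>x. _ * x"] if_distrib[of "\<lambda>x. x * _"] cong: if_cong)
  show ?thesis
    using 2 3 4 5 metric_frame_right[OF T(3), of k] by (simp add: mult.commute mult.left_commute)
qed

end


section \<open>Covariant derivatives along curves\<close>

lemma deriv_transform_open:
  assumes "open I" "t \<in> I" "(w has_field_derivative d) (at t)" "\<And>s. s \<in> I \<Longrightarrow> w s = u s"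
  shows "deriv u t = d"
  using has_field_derivative_transform_within_open[OF assms(3,1,2,4)] by (rule DERIV_imp_deriv)

text \<open>In a chart around \<open>c t\<close> the composite factors as (f o \<kappa>^-1) o
  (\<kappa> o c), which is valid on the set of times spent in the chart domain; that set is open
  because \<open>c\<close> is continuous on an open interval.\<close>

lemma smooth_fun_curve_differentiable:
  assumes atlas: "smooth_atlas A" and c: "smooth_curve A I c" and f: "smooth_fun A f" and t: "t \<in> I"
  shows "(\<lambda>s. f (c s)) differentiable (at t)"
proof -
  have "c t \<in> (\<Union>(U, \<kappa>)\<in>A. U)"
    using atlas unfolding smooth_atlas_def by simp
  then obtain U \<kappa> where U: "(U, \<kappa>) \<in> A" "c t \<in> U"
    by auto
  then have "open U" and hom: "homeomorphism U (\<kappa> ` U) \<kappa> (inv_into U \<kappa>)"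
    using atlas unfolding smooth_atlas_def by fast+
  define S where "S = I \<inter> c -` U"
  have "open S" "t \<in> S"
    unfolding S_def using c t U \<open>open U\<close>
    by (auto simp: smooth_curve_def intro!: continuous_open_preimage)
  have "smooth_on S (\<kappa> \<circ> c)"
    using c U by (auto simp: smooth_curve_def S_def)
  then have "Ck_on (Suc 0) S (\<kappa> \<circ> c)"
    unfolding smooth_on_def by blast
  then have 1: "(\<kappa> \<circ> c) differentiable (at t)"
    using \<open>t \<in> S\<close> by simp
  have "Ck_on (Suc 0) (\<kappa> ` U) (f \<circ> inv_into U \<kappa>)"
    using f U unfolding smooth_fun_def smooth_on_def by blast
  then have "(f \<circ> inv_into U \<kappa>) differentiable (at ((\<kappa> \<circ> c) t))"
    using U by simp
  from differentiable_chain_at[OF 1 this]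
  obtain D where D: "((f \<circ> inv_into U \<kappa>) \<circ> (\<kappa> \<circ> c) has_derivative D) (at t)"
    unfolding differentiable_def by blast
  have "((\<lambda>s. f (c s)) has_derivative D) (at t)"
    by (rule has_derivative_transform_within_open[OF D \<open>open S\<close> \<open>t \<in> S\<close>])
      (use hom in \<open>auto simp: S_def homeomorphism_def\<close>)
  then show ?thesis unfolding differentiable_def by blast
qed

section \<open>Existence of the covariant derivative along a curve\<close>

context orthogonal_frame
begin

text \<open>The vectors (e_i f)_i at \<open>p\<close>, for smooth \<open>f\<close>, form a subspace
  of R^3. A nonzero vector orthogonal to it would be a linear relation between the frame vectors at
  \<open>p\<close>, against uniqueness of coefficients. Thus the subspace is everything and contains
  the standard basis, with functions that are globally smooth, unlike local coordinates.\<close>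

lemma dual_functions:
  "\<exists>F. (\<forall>k. smooth_fun A (F k)) \<and> (\<forall>i k. e i p (F k) = (if i = k then 1 else 0))"
proof -
  define W where "W = {(\<chi> i. e i p f) :: real^3 |f. smooth_fun A f}"
  have "subspace W"
    unfolding subspace_def
  proof (intro conjI ballI allI)
    show "0 \<in> W"
      unfolding W_def
      by (auto intro!: exI[of _ "\<lambda>x. 0"] simp: smooth_fun_const vec_eq_iff tangent_const[OF frame_tangent])
    show "x + y \<in> W" if xy: "x \<in> W" "y \<in> W" for x y
    proof -
      obtain f f' where "smooth_fun A f" "x = (\<chi> i. e i p f)" "smooth_fun A f'" "y = (\<chi> i. e i p f')"
        using xy by (auto simp: W_def)
      then show ?thesis
        unfolding W_def
        by (auto intro!: exI[of _ "\<lambda>x. f x + f' x"] smooth_fun_add atlas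
            simp: vec_eq_iff tangent_add[OF frame_tangent])
    qed
    show "k *\<^sub>R x \<in> W" if x: "x \<in> W" for k x
    proof -
      obtain f where "smooth_fun A f" "x = (\<chi> i. e i p f)"
        using x by (auto simp: W_def)
      then show ?thesis
        unfolding W_def
        by (auto intro!: exI[of _ "\<lambda>x. k * f x"] smooth_fun_cmult atlas
            simp: vec_eq_iff tangent_cmult[OF frame_tangent])
    qed
  qed
  have "W = UNIV"
  proof (rule ccontr)
    assume "W \<noteq> UNIV"
    then have "span W \<noteq> UNIV"
      using span_eq_iff[of W] \<open>subspace W\<close> by metis
    then have "dim W < DIM(real^3)"
      using dim_eq_full[of W] dim_subset_UNIV[of W] by linarith
    then obtain x where x: "x \<noteq> 0" "\<And>y. y \<in> span W \<Longrightarrow> orthogonal x y"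
      using orthogonal_to_subspace_exists[of W] by blast
    have "(\<Sum>i\<in>UNIV. x $ i * e i p f) = 0" for f
    proof (cases "smooth_fun A f")
      case True
      then have "orthogonal x (\<chi> i. e i p f)"
        by (intro x(2) span_base) (auto simp: W_def)
      then show ?thesis
        by (simp add: orthogonal_def inner_vec_def)
    next
      case False
      then show ?thesis by (simp add: tangent_nonsmooth[OF frame_tangent])
    qed
    then have "(\<lambda>f. \<Sum>i\<in>UNIV. x $ i * e i p f) = (\<lambda>f. \<Sum>i\<in>UNIV. 0 * e i p f)"
      by simp
    then have "(\<chi> i. x $ i) = (\<chi> i. 0)"
      using coframe_lincomb[of p "\<lambda>i. x $ i"] coframe_lincomb[of p "\<lambda>i. 0"] by metis
    with x(1) show False by (simp add: vec_eq_iff)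
  qed
  then have "axis k 1 \<in> W" for k by simp
  then have "\<exists>f. smooth_fun A f \<and> axis k 1 = (\<chi> i. e i p f)" for k
    by (auto simp: W_def)
  then obtain F where "\<And>k. smooth_fun A (F k) \<and> axis k 1 = (\<chi> i. e i p (F k))"
    by metis
  then show ?thesis
    by (intro exI[of _ F]) (auto simp: vec_eq_iff axis_def)
qed

text \<open>The values of a field along a curve on functions dual to the frame at one point form a linear
  system for its components, which is nonsingular near that point; Cramer's rule applies.\<close>

lemma coframe_along_differentiable:
  assumes c: "smooth_curve A I c" and V: "vector_field_along A I c V" and t: "t \<in> I"
  shows "(\<lambda>s. coframe e (c s) (V s) $ i) differentiable (at t)"
proof -
  obtain F where F: "\<And>k. smooth_fun A (F k)"
    and dual: "\<And>i k. e i (c t) (F k) = (if i = k then 1 else 0)"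
    using dual_functions[of "c t"] by auto
  define M where "M s = (\<chi> k i. e i (c s) (F k))" for s
  have dM: "(\<lambda>s. e i (c s) (F k)) differentiable (at t)" for i k
    by (rule smooth_fun_curve_differentiable[OF atlas c vector_fieldD(2)[OF frame_vector_field F] t])
  have dV: "(\<lambda>s. V s (F k)) differentiable (at t)" for k
  proof -
    have "smooth_on I (\<lambda>s. V s (F k))"
      using V F by (auto simp: vector_field_along_def)
    then have "Ck_on (Suc 0) I (\<lambda>s. V s (F k))"
      unfolding smooth_on_def by blast
    then show ?thesis using t by simp
  qed
  have det_M: "(\<lambda>s. det (M s)) differentiable (at t)"
    unfolding det_3 M_def by (simp add: dM)
  have "det (M t) = 1"
    by (simp add: det_3 M_def dual)
  then have "\<forall>\<^sub>F s in at t. det (M s) \<noteq> 0"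
    using differentiable_imp_continuous_within[OF det_M] tendsto_imp_eventually_ne[of "\<lambda>s. det (M s)" 1 "at t" 0]
    by (simp add: continuous_within)
  then have "\<forall>\<^sub>F s in nhds t. det (M s) \<noteq> 0"
    using \<open>det (M t) = 1\<close> by (simp add: eventually_at_filter eventually_mono)
      (auto elim: eventually_mono)
  moreover have "\<forall>\<^sub>F s in nhds t. s \<in> I"
    using c t by (auto simp: smooth_curve_def eventually_nhds)
  ultimately have "\<forall>\<^sub>F s in nhds t. coframe e (c s) (V s) $ i =
      det (\<chi> k j. if j = i then V s (F k) else M s $ k $ j) / det (M s)"
  proof eventually_elim
    case (elim s)
    have v: "V s \<in> tangent_space A (c s)"
      using V elim by (auto simp: vector_field_along_def)
    have "M s *v coframe e (c s) (V s) = (\<chi> k. V s (F k))"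
      by (subst (2) coframe_expand[OF v]) (simp add: M_def matrix_vector_mult_def vec_eq_iff mult.commute)
    then show ?case
      unfolding cramer[OF elim(1)] by (simp add: vec_eq_iff cong: if_cong)
  qed
  then obtain S where S: "open S" "t \<in> S" "\<And>s. s \<in> S \<Longrightarrow> coframe e (c s) (V s) $ i =
      det (\<chi> k j. if j = i then V s (F k) else M s $ k $ j) / det (M s)"
    unfolding eventually_nhds by blast
  have "(\<lambda>s. det (\<chi> k j. if j = i then V s (F k) else M s $ k $ j) / det (M s)) differentiable (at t)"
  proof (rule differentiable_divide[OF _ det_M])
    show "(\<lambda>s. det (\<chi> k j. if j = i then V s (F k) else M s $ k $ j)) differentiable (at t)"
      using exhaust_3[of i] unfolding det_3 M_def by (auto simp: dM dV)
  qed (simp add: \<open>det (M t) = 1\<close>)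
  then obtain D where D: "((\<lambda>s. det (\<chi> k j. if j = i then V s (F k) else M s $ k $ j) / det (M s))
      has_derivative D) (at t)"
    unfolding differentiable_def by blast
  have "((\<lambda>s. coframe e (c s) (V s) $ i) has_derivative D) (at t)"
    by (rule has_derivative_transform_within_open[OF D S(1,2)]) (simp add: S(3))
  then show ?thesis unfolding differentiable_def by blast
qed

text \<open>Function linearity in \<open>X\<close> and the Leibniz rule in \<open>Y\<close>; the
  fields \<open>D (e j) (e i)\<close> stand in for Christoffel symbols and stay unevaluated. In this
  shape only the derivative of the components of \<open>Y\<close> along \<open>X\<close> refers to
  more than the point \<open>p\<close>.\<close>

lemma levi_civita_expand:
  assumes D: "levi_civita A g D" and X: "vector_field A X" and Y: "vector_field A Y"
  shows "D X Y p = (\<lambda>f. (\<Sum>i\<in>UNIV. X p (\<lambda>q. coframe e q (Y q) $ i) * e i p f)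
    + (\<Sum>i\<in>UNIV. \<Sum>j\<in>UNIV. coframe e p (Y p) $ i * coframe e p (X p) $ j * D (e j) (e i) p f))"
proof -
  note LC = levi_civitaD[OF D]
  note F = frame_vector_field
  \<comment> \<open>The connection axioms are stated for two summands, hence the nested binary form
    of the frame expansion.\<close>
  have comb: "Z = (\<lambda>p. (coframe e p (Z p) $ 1 \<odot>\<^sub>t e 1 p \<oplus>\<^sub>t coframe e p (Z p) $ 2 \<odot>\<^sub>t e 2 p)
      \<oplus>\<^sub>t coframe e p (Z p) $ 3 \<odot>\<^sub>t e 3 p)" if Z: "vector_field A Z" for Z
    by (intro ext) (subst (1) vector_field_expand[OF Z], simp add: sum_3 tplus_def tscale_def)
  have vf: "vector_field A (\<lambda>p. coframe e p (Z p) $ i \<odot>\<^sub>t e i p)" if Z: "vector_field A Z" for Z i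
    by (intro vector_field_scale atlas F smooth_coframe Z)
  have 1: "D X W p = (\<lambda>f. \<Sum>j\<in>UNIV. coframe e p (X p) $ j * D (e j) W p f)"
    if W: "vector_field A W" for W
  proof -
    have "D X W = D (\<lambda>p. (coframe e p (X p) $ 1 \<odot>\<^sub>t e 1 p \<oplus>\<^sub>t coframe e p (X p) $ 2 \<odot>\<^sub>t e 2 p)
      \<oplus>\<^sub>t coframe e p (X p) $ 3 \<odot>\<^sub>t e 3 p) W"
      using comb[OF X] by simp
    also have "\<dots> = (\<lambda>p. (coframe e p (X p) $ 1 \<odot>\<^sub>t D (e 1) W p \<oplus>\<^sub>t coframe e p (X p) $ 2 \<odot>\<^sub>t D (e 2) W p)
      \<oplus>\<^sub>t coframe e p (X p) $ 3 \<odot>\<^sub>t D (e 3) W p)"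
      by (simp add: LC(2) LC(3)[OF smooth_coframe[OF X] F W] vf[OF X] W vector_field_plus[OF atlas])
    finally show ?thesis
      by (simp add: fun_eq_iff sum_3 tplus_def tscale_def)
  qed
  have "D X Y = D X (\<lambda>p. (coframe e p (Y p) $ 1 \<odot>\<^sub>t e 1 p \<oplus>\<^sub>t coframe e p (Y p) $ 2 \<odot>\<^sub>t e 2 p)
      \<oplus>\<^sub>t coframe e p (Y p) $ 3 \<odot>\<^sub>t e 3 p)"
    using comb[OF Y] by simp
  also have "\<dots> = (\<lambda>p. ((X p (\<lambda>q. coframe e q (Y q) $ 1) \<odot>\<^sub>t e 1 p \<oplus>\<^sub>t coframe e p (Y p) $ 1 \<odot>\<^sub>t D X (e 1) p)
      \<oplus>\<^sub>t (X p (\<lambda>q. coframe e q (Y q) $ 2) \<odot>\<^sub>t e 2 p \<oplus>\<^sub>t coframe e p (Y p) $ 2 \<odot>\<^sub>t D X (e 2) p))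
      \<oplus>\<^sub>t (X p (\<lambda>q. coframe e q (Y q) $ 3) \<odot>\<^sub>t e 3 p \<oplus>\<^sub>t coframe e p (Y p) $ 3 \<odot>\<^sub>t D X (e 3) p))"
    by (simp add: LC(4) LC(5)[OF smooth_coframe[OF Y] X F] vf[OF Y] X vector_field_plus[OF atlas])
  finally show ?thesis
    by (simp add: fun_eq_iff sum_3 tplus_def tscale_def 1[OF F] algebra_simps)
qed

text \<open>The formula of \<open>levi_civita_expand\<close> with the derivatives of the components
  along \<open>X\<close> replaced by time derivatives, so that it makes sense for fields known only
  along \<open>c\<close>. It is the witness for the operator that
  \<open>charged_particle_orbit\<close> demands.\<close>

definition frame_deriv_along where
  "frame_deriv_along D c V t = (\<lambda>f. (\<Sum>i\<in>UNIV. deriv (\<lambda>s. coframe e (c s) (V s) $ i) t * e i (c t) f)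
    + (\<Sum>i\<in>UNIV. \<Sum>j\<in>UNIV. coframe e (c t) (V t) $ i * coframe e (c t) (velocity A c t) $ j *
        D (e j) (e i) (c t) f))"

text \<open>The time derivative of a component of \<open>Y\<close> along \<open>c\<close> is the
  velocity applied to that component, by definition of \<open>velocity\<close>, and the velocity is
  the value of \<open>X\<close>.\<close>

lemma frame_deriv_along_vector_field:
  assumes D: "levi_civita A g D" and c: "smooth_curve A I c" and Y: "vector_field A Y"
    and VY: "\<forall>t\<in>I. V t = Y (c t)" and t: "t \<in> I"
    and X: "vector_field A X" and Xt: "X (c t) = velocity A c t"
  shows "frame_deriv_along D c V t = D X Y (c t)"
proof -
  have "open I" using c by (simp add: smooth_curve_def)
  have "deriv (\<lambda>s. coframe e (c s) (V s) $ i) t = X (c t) (\<lambda>q. coframe e q (Y q) $ i)" for i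
  proof (rule deriv_transform_open[OF \<open>open I\<close> t])
    show "((\<lambda>s. coframe e (c s) (Y (c s)) $ i) has_real_derivative
        X (c t) (\<lambda>q. coframe e q (Y q) $ i)) (at t)"
      using smooth_fun_curve_differentiable[OF atlas c smooth_coframe[OF Y, of i] t]
      by (simp add: Xt velocity_def smooth_coframe[OF Y] comp_def DERIV_deriv_iff_real_differentiable)
  qed (simp add: VY)
  then show ?thesis
    by (simp add: levi_civita_expand[OF D X Y] frame_deriv_along_def VY t Xt)
qed

text \<open>Additivity and the Leibniz rule are the sum and product rules for the components, which
  \<open>coframe_along_differentiable\<close> makes available; agreement with \<open>D\<close> is
  the preceding lemma.\<close>

lemma covariant_deriv_along_frame:
  assumes D: "levi_civita A g D" and c: "smooth_curve A I c"
  shows "covariant_deriv_along A D I c (frame_deriv_along D c)"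
proof -
  note F = frame_vector_field
  note LC = levi_civitaD(1)[OF D]
  have "open I" using c by (simp add: smooth_curve_def)
  have dv: "((\<lambda>s. coframe e (c s) (V s) $ i) has_real_derivative
      deriv (\<lambda>s. coframe e (c s) (V s) $ i) t) (at t)"
    if "vector_field_along A I c V" "t \<in> I" for V t i
    using coframe_along_differentiable[OF c that]
    by (metis DERIV_deriv_iff_real_differentiable)
  have tan: "V t \<in> tangent_space A (c t)" if "vector_field_along A I c V" "t \<in> I" for V t
    using that by (auto simp: vector_field_along_def)
  show ?thesis
    unfolding covariant_deriv_along_def
  proof (intro conjI allI impI ballI)
    fix V t assume "vector_field_along A I c V" "t \<in> I"
    \<comment> \<open>The factor 1 brings the outer sum into the shape expected by
      \<open>tangent_space_sum\<close>.\<close>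
    have "frame_deriv_along D c V t =
      (\<lambda>f. \<Sum>i\<in>UNIV. deriv (\<lambda>s. coframe e (c s) (V s) $ i) t * e i (c t) f) \<oplus>\<^sub>t
      (\<lambda>f. \<Sum>i\<in>UNIV. 1 * (\<Sum>j\<in>UNIV. coframe e (c t) (V t) $ i *
        coframe e (c t) (velocity A c t) $ j * D (e j) (e i) (c t) f))"
      by (simp add: frame_deriv_along_def tplus_def)
    also have "\<dots> \<in> tangent_space A (c t)"
      by (intro tangent_space_plus tangent_space_sum vector_fieldD(1) F LC)
    finally show "frame_deriv_along D c V t \<in> tangent_space A (c t)" .
  next
    fix V W t assume V: "vector_field_along A I c V" and W: "vector_field_along A I c W" and t: "t \<in> I"
    have "deriv (\<lambda>s. coframe e (c s) (V s \<oplus>\<^sub>t W s) $ i) t =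
      deriv (\<lambda>s. coframe e (c s) (V s) $ i) t + deriv (\<lambda>s. coframe e (c s) (W s) $ i) t" for i
      by (rule deriv_transform_open[OF \<open>open I\<close> t DERIV_add[OF dv[OF V t] dv[OF W t]]])
        (simp add: coframe_plus[OF tan[OF V] tan[OF W]])
    then have "frame_deriv_along D c (\<lambda>s. V s \<oplus>\<^sub>t W s) t = (\<lambda>h.
        (\<Sum>i\<in>UNIV. (deriv (\<lambda>s. coframe e (c s) (V s) $ i) t +
          deriv (\<lambda>s. coframe e (c s) (W s) $ i) t) * e i (c t) h) +
        (\<Sum>i\<in>UNIV. \<Sum>j\<in>UNIV. (coframe e (c t) (V t) $ i + coframe e (c t) (W t) $ i) *
          coframe e (c t) (velocity A c t) $ j * D (e j) (e i) (c t) h))"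
      by (simp only: frame_deriv_along_def coframe_plus[OF tan[OF V t] tan[OF W t]] vector_add_component)
    then show "frame_deriv_along D c (\<lambda>s. V s \<oplus>\<^sub>t W s) t =
        frame_deriv_along D c V t \<oplus>\<^sub>t frame_deriv_along D c W t"
      by (simp add: frame_deriv_along_def tplus_def sum.distrib distrib_right add_ac)
  next
    fix f :: "real \<Rightarrow> real" and V t assume f: "smooth_on I f" and V: "vector_field_along A I c V" and t: "t \<in> I"
    have "Ck_on (Suc 0) I f"
      using f unfolding smooth_on_def by blast
    then have df: "(f has_real_derivative deriv f t) (at t)"
      using t by (simp add: DERIV_deriv_iff_real_differentiable)
    have "deriv (\<lambda>s. coframe e (c s) (f s \<odot>\<^sub>t V s) $ i) t =
      deriv f t * coframe e (c t) (V t) $ i + deriv (\<lambda>s. coframe e (c s) (V s) $ i) t * f t" for i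
      by (rule deriv_transform_open[OF \<open>open I\<close> t DERIV_mult[OF df dv[OF V t]]])
        (simp add: coframe_scale[OF tan[OF V]])
    then have "frame_deriv_along D c (\<lambda>s. f s \<odot>\<^sub>t V s) t = (\<lambda>h.
        (\<Sum>i\<in>UNIV. (deriv f t * coframe e (c t) (V t) $ i +
          deriv (\<lambda>s. coframe e (c s) (V s) $ i) t * f t) * e i (c t) h) +
        (\<Sum>i\<in>UNIV. \<Sum>j\<in>UNIV. (f t *\<^sub>R coframe e (c t) (V t) $ i) *
          coframe e (c t) (velocity A c t) $ j * D (e j) (e i) (c t) h))"
      by (simp only: frame_deriv_along_def coframe_scale[OF tan[OF V t]] vector_scaleR_component)
    moreover have "deriv f t \<odot>\<^sub>t V t =
        (\<lambda>h. \<Sum>i\<in>UNIV. deriv f t * coframe e (c t) (V t) $ i * e i (c t) h)"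
      by (subst (1) coframe_expand[OF tan[OF V t]]) (simp add: tscale_def sum_distrib_left mult.assoc)
    ultimately show "frame_deriv_along D c (\<lambda>s. f s \<odot>\<^sub>t V s) t =
        deriv f t \<odot>\<^sub>t V t \<oplus>\<^sub>t f t \<odot>\<^sub>t frame_deriv_along D c V t"
      by (simp add: frame_deriv_along_def tplus_def tscale_def[of "f t"]
          sum.distrib sum_distrib_left distrib_left distrib_right mult.assoc mult.left_commute
          add.assoc)
  next
    fix V Y t X
    assume "vector_field A Y" "\<forall>t\<in>I. V t = Y (c t)" "t \<in> I" "vector_field A X" "X (c t) = velocity A c t"
    then show "frame_deriv_along D c V t = D X Y (c t)"
      using frame_deriv_along_vector_field[OF D c] by blast
  qed
qed

end


section \<open>The Dirac current of an SqK-spinor\<close>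

text \<open>Each component is a constant times a polynomial written with sums, differences and
  products only, so that the rules for smooth functions and for derivations apply syntactically;
  this explains the factors \<open>- 1\<close> and the squares spelled out as products.\<close>

lemma dirac_coeff_components:
  fixes u :: "complex^2"
  shows "Re (dirac_coeff 0 u 1) = - 2 * (Re (u $ 1) * Re (u $ 2) + Im (u $ 1) * Im (u $ 2))"
    and "Re (dirac_coeff 0 u 2) = - 2 * (Re (u $ 1) * Im (u $ 2) - Im (u $ 1) * Re (u $ 2))"
    and "Re (dirac_coeff 0 u 3) = - 1 * (Re (u $ 1) * Re (u $ 1) + Im (u $ 1) * Im (u $ 1)
      - (Re (u $ 2) * Re (u $ 2) + Im (u $ 2) * Im (u $ 2)))"
    and "Re (dirac_coeff 1 u 1) = - 1 * (Re (u $ 1) * Re (u $ 1) + Im (u $ 1) * Im (u $ 1)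
      + (Re (u $ 2) * Re (u $ 2) + Im (u $ 2) * Im (u $ 2)))"
    and "Re (dirac_coeff 1 u 2) = - 1 * (Re (u $ 1) * Re (u $ 1) + Im (u $ 1) * Im (u $ 1)
      - (Re (u $ 2) * Re (u $ 2) + Im (u $ 2) * Im (u $ 2)))"
    and "Re (dirac_coeff 1 u 3) = 2 * (Re (u $ 1) * Im (u $ 2) - Im (u $ 1) * Re (u $ 2))"
  by (simp_all add: dirac_coeff_def spin_form_def gamma_up_def gamma_def pauli_def hmat_def
      sum_2 sum_3 matrix_vector_mult_def power_int_minus algebra_simps)

locale sqk_spinor_frame = orthogonal_frame +
  fixes r :: nat and H a b :: real and \<xi> \<eta> \<psi>
  assumes r: "r \<in> {0, 1}"
    and frame_1: "e 1 = \<xi>"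
    and eta_frame: "\<eta> p (e i p) = (if i = 1 then 1 else 0)"
    and sqk: "sqk_spinor r H A \<xi> \<eta> e a b \<psi>"
begin

abbreviation J where "J \<equiv> dirac_current r e \<psi>"

abbreviation j where "j k p \<equiv> Re (dirac_coeff r (\<psi> p) k)"

lemma smooth_spinor:
  "smooth_fun A (\<lambda>p. Re (\<psi> p $ k))" "smooth_fun A (\<lambda>p. Im (\<psi> p $ k))"
  using sqk by (auto simp: sqk_spinor_def spinor_field_def)

lemma smooth_dirac_coeff: "smooth_fun A (j k)"
proof -
  have "k = 1 \<or> k = 2 \<or> k = 3" by (rule exhaust_3)
  then show ?thesis
    using r by (auto simp only: insert_iff empty_iff dirac_coeff_components
        intro!: smooth_fun_cmult smooth_fun_add smooth_fun_diff smooth_fun_mult smooth_spinor atlas)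
qed

lemma vector_field_dirac_current: "vector_field A J"
  unfolding dirac_current_def[abs_def]
  by (intro vector_field_sum atlas frame_vector_field smooth_dirac_coeff)

lemma coframe_dirac_current: "coframe e p (J p) $ k = j k p"
  by (simp add: dirac_current_def coframe_lincomb)

lemma spinor_deriv_frame:
  "spinor_deriv (e i p) \<psi> =
    (of_real (a - (-1) ^ r / 2 + (if i = 1 then b - (H - (-1) ^ r) / 4 else 0)) * \<i> ^ r) *s gamma r i (\<psi> p)"
proof -
  have C: "clifford r e p (e i p) u = gamma r i u" for i u
    by (simp add: clifford_def coframe_frame if_distrib[of of_real] if_distrib[of "\<lambda>x. x *s _"] cong: if_cong)
  have S: "(\<Sum>j\<in>UNIV. complex_of_real (coframe e p (e i p) $ j) *s gamma r j u) = gamma r i u" for u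
    using C unfolding clifford_def .
  have "spin_covariant_deriv r H e p (e i p) \<psi> =
      (of_real a * \<i> ^ r) *s clifford r e p (e i p) (\<psi> p)
      + (of_real b * \<i> ^ r * of_real (\<eta> p (e i p))) *s clifford r e p (\<xi> p) (\<psi> p)"
    using sqk frame_vector_field by (simp add: sqk_spinor_def)
  then have "spinor_deriv (e i p) \<psi> =
      (of_real a * \<i> ^ r - (-\<i>) ^ r / 2) *s gamma r i (\<psi> p)
      + (of_real b * \<i> ^ r * of_real (\<eta> p (e i p))
        - \<i> ^ r * of_real ((H + (-1) powi (int r - 1)) / 4) * of_real (coframe e p (e i p) $ 1)) *s gamma r 1 (\<psi> p)"
    unfolding spin_covariant_deriv_def spin_connection_form_def S frame_1[symmetric] C
    by (simp add: vec_eq_iff algebra_simps)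
  \<comment> \<open>Both coefficients of the spin connection are brought over the common factor
    \<open>\<i> ^ r\<close>; this is the origin of (-1)^r / 2 and (H - (-1)^r) / 4.\<close>
  moreover have "(-\<i>) ^ r = of_real ((-1) ^ r) * \<i> ^ r" "(-1) powi (int r - 1) = - ((-1::real) ^ r)"
    using r by auto
  ultimately show ?thesis
    by (auto simp: eta_frame coframe_frame vec_eq_iff algebra_simps add_divide_distrib diff_divide_distrib)
qed

text \<open>Differentiating along \<open>e i\<close> acts on the components of J as an infinitesimal
  isometry that annihilates the \<open>i\<close>-th one: a rotation, or a boost if r = 1 and i is 2
  or 3. Its rate is 2\<alpha>, up to orientation, with the additional 2\<beta> only for i =
  1.\<close>

lemma dirac_coeff_derivative:
  defines "\<alpha> \<equiv> a - (-1) ^ r / 2" and "\<beta> \<equiv> b - (H - (-1) ^ r) / 4"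
  shows "e 1 p (j 1) = 0" "e 1 p (j 2) = 2 * (\<alpha> + \<beta>) * j 3 p" "e 1 p (j 3) = - 2 * (\<alpha> + \<beta>) * j 2 p"
    and "e 2 p (j 1) = - 2 * (-1) ^ r * \<alpha> * j 3 p" "e 2 p (j 2) = 0" "e 2 p (j 3) = 2 * \<alpha> * j 1 p"
    and "e 3 p (j 1) = 2 * (-1) ^ r * \<alpha> * j 2 p" "e 3 p (j 2) = - 2 * \<alpha> * j 1 p" "e 3 p (j 3) = 0"
proof -
  note T = tangent_cmult[OF frame_tangent] tangent_add[OF frame_tangent]
    tangent_diff[OF atlas frame_tangent] tangent_mult[OF frame_tangent]
  note S = smooth_fun_cmult smooth_fun_add smooth_fun_diff smooth_fun_mult smooth_spinor atlas
  \<comment> \<open>The rates remain opaque during the componentwise computation; fact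
    \<open>g\<close> resolves them only at the end.\<close>
  define \<gamma> where "\<gamma> i = \<alpha> + (if i = (1::3) then \<beta> else 0)" for i
  have D: "spinor_deriv (e i p) \<psi> = (of_real (\<gamma> i) * \<i> ^ r) *s gamma r i (\<psi> p)" for i
    unfolding spinor_deriv_frame \<gamma>_def \<alpha>_def \<beta>_def by simp
  have R: "e i p (\<lambda>q. Re (\<psi> q $ k)) = Re (((of_real (\<gamma> i) * \<i> ^ r) *s gamma r i (\<psi> p)) $ k)"
    "e i p (\<lambda>q. Im (\<psi> q $ k)) = Im (((of_real (\<gamma> i) * \<i> ^ r) *s gamma r i (\<psi> p)) $ k)" for i k
    unfolding D[symmetric] by (simp_all add: spinor_deriv_def)
  have g: "\<gamma> 1 = \<alpha> + \<beta>" "\<gamma> 2 = \<alpha>" "\<gamma> 3 = \<alpha>"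
    by (simp_all add: \<gamma>_def)
  consider "r = 0" | "r = 1" using r by auto
  then have "e 1 p (j 1) = 0 \<and> e 1 p (j 2) = 2 * \<gamma> 1 * j 3 p \<and> e 1 p (j 3) = - 2 * \<gamma> 1 * j 2 p
    \<and> e 2 p (j 1) = - 2 * (-1) ^ r * \<gamma> 2 * j 3 p \<and> e 2 p (j 2) = 0 \<and> e 2 p (j 3) = 2 * \<gamma> 2 * j 1 p
    \<and> e 3 p (j 1) = 2 * (-1) ^ r * \<gamma> 3 * j 2 p \<and> e 3 p (j 2) = - 2 * \<gamma> 3 * j 1 p \<and> e 3 p (j 3) = 0"
  proof cases
    case 1
    show ?thesis
      unfolding 1 dirac_coeff_components
      by (simp only: T S R 1) (simp add: gamma_def pauli_def matrix_vector_mult_def sum_2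
          power_int_minus algebra_simps)
  next
    case 2
    show ?thesis
      unfolding 2 dirac_coeff_components
      by (simp only: T S R 2) (simp add: gamma_def pauli_def matrix_vector_mult_def sum_2
          power_int_minus algebra_simps)
  qed
  then show "e 1 p (j 1) = 0" "e 1 p (j 2) = 2 * (\<alpha> + \<beta>) * j 3 p" "e 1 p (j 3) = - 2 * (\<alpha> + \<beta>) * j 2 p"
    and "e 2 p (j 1) = - 2 * (-1) ^ r * \<alpha> * j 3 p" "e 2 p (j 2) = 0" "e 2 p (j 3) = 2 * \<alpha> * j 1 p"
    and "e 3 p (j 1) = 2 * (-1) ^ r * \<alpha> * j 2 p" "e 3 p (j 2) = - 2 * \<alpha> * j 1 p" "e 3 p (j 3) = 0"
    unfolding g by blast+
qed

text \<open>Contracting the isometries of rate \<alpha> with J gives the cross product of J with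
  itself, so \<alpha> drops out. What survives is the extra rotation about the Reeb direction,
  weighted by the first component of J.\<close>

lemma dirac_current_derivative:
  shows "J p (j 1) = 0"
    and "J p (j 2) = 2 * (b - (H - (-1) ^ r) / 4) * j 1 p * j 3 p"
    and "J p (j 3) = - 2 * (b - (H - (-1) ^ r) / 4) * j 1 p * j 2 p"
  unfolding dirac_current_def sum_3 dirac_coeff_derivative by (simp_all add: algebra_simps)

end


section \<open>The force law and the orbits in a Sasakian frame\<close>

locale sasakian_sqk_spinor_frame = sqk_spinor_frame +
  assumes h_hmat: "h i = hmat r $ i $ i"
    and eta: "one_form A \<eta>"
    and bracket:
      "lie_bracket (e 1) (e 2) p = (- ((H + (-1) ^ r * 3) / 2)) \<odot>\<^sub>t e 3 p"
      "lie_bracket (e 1) (e 3) p = ((H + (-1) ^ r * 3) / 2) \<odot>\<^sub>t e 2 p"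
      "lie_bracket (e 2) (e 3) p = (-2) \<odot>\<^sub>t e 1 p"
begin

text \<open>The vanishing brackets are written as 0 times a frame vector, so that every bracket is a
  multiple of a frame vector and one scaling rule evaluates them all.\<close>

lemma bracket_swapped:
  "lie_bracket (e 2) (e 1) p = ((H + (-1) ^ r * 3) / 2) \<odot>\<^sub>t e 3 p"
  "lie_bracket (e 3) (e 1) p = (- ((H + (-1) ^ r * 3) / 2)) \<odot>\<^sub>t e 2 p"
  "lie_bracket (e 3) (e 2) p = 2 \<odot>\<^sub>t e 1 p"
  "lie_bracket (e i) (e i) p = 0 \<odot>\<^sub>t e i p"
  by (simp_all only: lie_bracket_swap[of "e 2" "e 1"] lie_bracket_swap[of "e 3"] bracket)
    (simp_all add: lie_bracket_def tscale_def)

lemma h_values: "h 1 = (-1) ^ r" "h 2 = 1" "h 3 = 1"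
  by (simp_all add: h_hmat hmat_def)

lemma metric_dirac_current_reeb: "g p (J p) (\<xi> p) = (-1) ^ r * j 1 p"
  using metric_frame_right[OF vector_fieldD(1)[OF vector_field_dirac_current], of p 1]
  by (simp add: frame_1 coframe_dirac_current h_values)

text \<open>\<eta> is constant on the frame, so only the terms -\<eta>([e_i, e_j]) remain, and among
  the brackets only that of \<open>e 2\<close> and \<open>e 3\<close> has a Reeb component, namely
  -2.\<close>

lemma ext_deriv1_eta:
  assumes v: "v \<in> tangent_space A p" and w: "w \<in> tangent_space A p"
  shows "ext_deriv1 A \<eta> p v w =
    2 * (coframe e p v $ 2 * coframe e p w $ 3 - coframe e p v $ 3 * coframe e p w $ 2)"
  by (simp add: ext_deriv1_coframe[OF eta v w] sum_3 bracket bracket_swapped eta_frame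
      one_formD(2)[OF eta frame_tangent] tangent_const[OF frame_tangent] algebra_simps)

text \<open>Put s = (-1)^r. In the second and third components the spinor equation contributes 2b -
  (H - s)/2, the brackets with \<open>e 1\<close> contribute (H + 3s)/2 and that of
  \<open>e 2\<close> and \<open>e 3\<close> contributes -2s, up to a common sign. The total is 2b,
  and H disappears. In the Reeb component the two bracket terms cancel.\<close>

lemma levi_civita_dirac_current:
  assumes D: "levi_civita A g D"
  shows "D J J p =
    ((-1) powi (int r - 1) * b * g p (J p) (\<xi> p)) \<odot>\<^sub>t sharp A g p (ext_deriv1 A \<eta> p (J p))"
proof -
  note T = vector_fieldD(1)[OF vector_field_dirac_current, of p]
  have lin: "ext_deriv1 A \<eta> p (J p) (v \<oplus>\<^sub>t w) = ext_deriv1 A \<eta> p (J p) v + ext_deriv1 A \<eta> p (J p) w"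
    "ext_deriv1 A \<eta> p (J p) (c \<odot>\<^sub>t v) = c * ext_deriv1 A \<eta> p (J p) v"
    if "v \<in> tangent_space A p" "w \<in> tangent_space A p" for v w c
    using that
    by (simp_all add: ext_deriv1_eta[OF T] tangent_space_plus tangent_space_scale coframe_plus
        coframe_scale algebra_simps)
  note sharp = sharp_tangent[of p "ext_deriv1 A \<eta> p (J p)", OF lin(1) lin(2)]
    coframe_sharp[of p "ext_deriv1 A \<eta> p (J p)", OF lin(1) lin(2)]
  have gJ: "g p (J p) (c \<odot>\<^sub>t e k p) = c * (h k * j k p)" for c k
    using bilinear_fieldD(4)[OF bilinear frame_tangent T] metric_frame_right[OF T]
    by (simp add: coframe_dirac_current)
  have DJ: "h k * coframe e p (D J J p) $ k = h k * J p (j k)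
    - (\<Sum>i\<in>UNIV. j i p * g p (J p) (lie_bracket (e i) (e k) p))" for k
    using levi_civita_self[OF D vector_field_dirac_current, of k p]
    by (simp add: coframe_dirac_current)
  have k: "coframe e p (D J J p) $ k = - b * j 1 p * (ext_deriv1 A \<eta> p (J p) (e k p) / h k)" for k
  proof -
    have "k = 1 \<or> k = 2 \<or> k = 3" by (rule exhaust_3)
    then show ?thesis
      using DJ[of k]
      by (auto simp: sum_3 bracket bracket_swapped gJ h_values dirac_current_derivative
          ext_deriv1_eta[OF T frame_tangent] coframe_dirac_current coframe_frame field_simps)
  qed
  \<comment> \<open>By g(J, \<xi>) = (-1)^r J^1 the signs combine to -1, so the charge is -b J^1 in
    either signature.\<close>
  have c: "(-1) powi (int r - 1) * b * g p (J p) (\<xi> p) = - b * j 1 p"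
    using r by (auto simp: metric_dirac_current_reeb)
  show ?thesis
    unfolding c
    by (subst tangent_eq_iff_coframe[of _ p])
      (use levi_civitaD(1)[OF D vector_field_dirac_current vector_field_dirac_current]
       in \<open>simp_all add: vector_fieldD(1) tangent_space_scale sharp coframe_scale vec_eq_iff k\<close>)
qed

text \<open>Along an integral curve the time derivative of the Reeb component is J applied to it,
  hence 0, and the parameter domain is an interval. The component differs from g(J, \<xi>) only by
  the constant sign (-1)^r.\<close>

lemma dirac_current_reeb_constant:
  assumes c: "integral_curve A J I c" and s: "s \<in> I" and t: "t \<in> I"
  shows "j 1 (c s) = j 1 (c t)"
proof -
  have smooth: "smooth_curve A I c" and vel: "\<And>t. t \<in> I \<Longrightarrow> velocity A c t = J (c t)"
    using c by (auto simp: integral_curve_def)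
  then have "convex I"
    by (simp add: smooth_curve_def is_interval_convex_1)
  have "((\<lambda>t. j 1 (c t)) has_real_derivative 0) (at t within I)" if t: "t \<in> I" for t
  proof -
    have "deriv (\<lambda>t. j 1 (c t)) t = velocity A c t (j 1)"
      by (simp add: velocity_def smooth_dirac_coeff comp_def)
    also have "\<dots> = 0"
      by (simp add: vel[OF t] dirac_current_derivative)
    finally show ?thesis
      using smooth_fun_curve_differentiable[OF atlas smooth smooth_dirac_coeff t, of 1]
      by (metis DERIV_deriv_iff_real_differentiable has_field_derivative_at_within)
  qed
  then obtain k where "\<And>t. t \<in> I \<Longrightarrow> j 1 (c t) = k"
    using has_field_derivative_zero_constant[OF \<open>convex I\<close>, of "\<lambda>t. j 1 (c t)"] by blast
  then show ?thesis using s t by simp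
qed

text \<open>The velocity is the restriction of the field J, so its derivative along \<open>c\<close>
  is \<open>D J J\<close>. A charge is one number per curve, whereas the force law has a coefficient
  at each point; constancy lets the value at \<open>t0\<close> serve for all times.\<close>

lemma integral_curve_charged_particle:
  assumes D: "levi_civita A g D" and c: "integral_curve A J I c" and t0: "t0 \<in> I"
  shows "charged_particle_orbit A g D (ext_deriv1 A \<eta>)
    ((-1) powi (int r - 1) * b * g (c t0) (J (c t0)) (\<xi> (c t0))) I c"
  unfolding charged_particle_orbit_def
proof (intro conjI exI ballI)
  show "closed_two_form A (ext_deriv1 A \<eta>)"
    by (rule closed_ext_deriv1[OF eta])
  show smooth: "smooth_curve A I c"
    using c by (simp add: integral_curve_def)
  show cov: "covariant_deriv_along A D I c (frame_deriv_along D c)"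
    by (rule covariant_deriv_along_frame[OF D smooth])
  fix t assume t: "t \<in> I"
  have vel: "\<And>t. t \<in> I \<Longrightarrow> velocity A c t = J (c t)"
    using c by (auto simp: integral_curve_def)
  have "frame_deriv_along D c (velocity A c) t = D J J (c t)"
    by (rule frame_deriv_along_vector_field[OF D smooth vector_field_dirac_current _ t
          vector_field_dirac_current]) (simp_all add: vel t)
  also have "\<dots> = ((-1) powi (int r - 1) * b * g (c t0) (J (c t0)) (\<xi> (c t0))) \<odot>\<^sub>t
      sharp A g (c t) (ext_deriv1 A \<eta> (c t) (velocity A c t))"
    using dirac_current_reeb_constant[OF c t0 t]
    by (simp add: levi_civita_dirac_current[OF D] metric_dirac_current_reeb vel[OF t])
  finally show "frame_deriv_along D c (velocity A c) t =
      ((-1) powi (int r - 1) * b * g (c t0) (J (c t0)) (\<xi> (c t0))) \<odot>\<^sub>t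
      sharp A g (c t) (ext_deriv1 A \<eta> (c t) (velocity A c t))" .
qed

end


section \<open>Sasakian space-forms\<close>

text \<open>The point is \<phi>\<xi> = 0; compatibility of the metric with \<phi> then gives 0 =
  g(v, \<xi>) - \<eta>(v).\<close>

lemma contact_metric_eta:
  assumes "contact_metric A \<phi> \<xi> \<eta> g" and v: "v \<in> tangent_space A p"
  shows "\<eta> p v = g p v (\<xi> p)"
proof -
  have \<phi>: "endomorphism_field A \<phi>" and \<xi>: "vector_field A \<xi>" and \<eta>: "one_form A \<eta>"
    and g: "riemannian_metric A g" and 1: "\<eta> p (\<xi> p) = 1"
    and sq: "\<And>v. v \<in> tangent_space A p \<Longrightarrow> \<phi> p (\<phi> p v) = (-1) \<odot>\<^sub>t v \<oplus>\<^sub>t \<eta> p v \<odot>\<^sub>t \<xi> p"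
    and comp: "\<And>v w. v \<in> tangent_space A p \<Longrightarrow> w \<in> tangent_space A p \<Longrightarrow>
      g p (\<phi> p v) (\<phi> p w) = g p v w - \<eta> p v * \<eta> p w"
    using assms(1) unfolding contact_metric_def by blast+
  have B: "bilinear_field A g"
    using g by (simp add: riemannian_metric_def)
  have T: "\<xi> p \<in> tangent_space A p"
    by (rule vector_fieldD(1)[OF \<xi>])
  have \<phi>T: "\<phi> p v \<in> tangent_space A p" if "v \<in> tangent_space A p" for v
    using \<phi> that by (auto simp: endomorphism_field_def)
  have \<phi>scale: "\<phi> p (c \<odot>\<^sub>t v) = c \<odot>\<^sub>t \<phi> p v" if "v \<in> tangent_space A p" for c v
    using \<phi> that by (auto simp: endomorphism_field_def)
  have "\<phi> p (\<phi> p (\<xi> p)) = tzero"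
    by (simp add: sq[OF T] 1) (simp add: tplus_def tscale_def tzero_def)
  moreover define c where "c = \<eta> p (\<phi> p (\<xi> p))"
  moreover have "\<phi> p tzero = tzero"
    using \<phi>scale[OF tangent_space_zero, of 0] by (simp add: tscale_def tzero_def)
  \<comment> \<open>\<phi>^3 \<xi> is computed twice: as \<phi>(\<phi>^2 \<xi>) = 0 and as \<phi>^2
    applied to \<phi>\<xi>. Hence \<phi>\<xi> is a multiple c \<xi>, and \<phi>^2 \<xi> = 0 forces
    c^2 = 0.\<close>
  ultimately have "tzero = (-1) \<odot>\<^sub>t \<phi> p (\<xi> p) \<oplus>\<^sub>t c \<odot>\<^sub>t \<xi> p"
    using sq[OF \<phi>T[OF T]] by simp
  then have c\<xi>: "\<phi> p (\<xi> p) = c \<odot>\<^sub>t \<xi> p"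
    by (simp add: fun_eq_iff tplus_def tscale_def tzero_def)
  have "(c * c) \<odot>\<^sub>t \<xi> p = tzero"
    using \<open>\<phi> p (\<phi> p (\<xi> p)) = tzero\<close> \<phi>scale[OF T, of c] by (simp add: c\<xi> tscale_def mult.assoc)
  then have "c * c = 0"
    using one_formD(2)[OF \<eta> T, of "c * c"] one_formD(2)[OF \<eta> T, of 0] 1
    by (simp add: tscale_def tzero_def)
  then have "\<phi> p (\<xi> p) = 0 \<odot>\<^sub>t \<xi> p"
    using c\<xi> by simp
  then have "g p (\<phi> p v) (\<phi> p (\<xi> p)) = 0"
    using bilinear_fieldD(4)[OF B T \<phi>T[OF v], of 0] by simp
  then show ?thesis
    using comp[OF v T] 1 by simp
qed

theorem proposition3p5:
  fixes A :: "('m::{t2_space,second_countable_topology}, real^3) atlas"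
    and \<phi> :: "'m \<Rightarrow> 'm tvec \<Rightarrow> 'm tvec"
    and \<xi> :: "'m vfield"
    and \<eta> :: "'m \<Rightarrow> 'm tvec \<Rightarrow> real"
    and g :: "'m \<Rightarrow> 'm tvec \<Rightarrow> 'm tvec \<Rightarrow> real"
    and D :: "'m vfield \<Rightarrow> 'm vfield \<Rightarrow> 'm vfield"
    and e :: "3 \<Rightarrow> 'm vfield"
    and \<psi> :: "'m \<Rightarrow> complex^2"
    and r :: nat and H a b :: real
  assumes "r \<in> {0, 1}"
    and "sasakian_space_form r H A \<phi> \<xi> \<eta> g D"
    and "sasakian_frame r H A \<xi> g e"
    and "sqk_spinor r H A \<xi> \<eta> e a b \<psi>"
    and "b \<noteq> 0"
  shows "let J = dirac_current r e \<psi> in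
    (\<forall>I c. integral_curve A J I c \<longrightarrow>
       (\<exists>k. \<forall>t\<in>I. g (c t) (J (c t)) (\<xi> (c t)) = k)) \<and>
    (\<forall>p. D J J p =
       ((-1) powi (int r - 1) * b * g p (J p) (\<xi> p)) \<odot>\<^sub>t sharp A g p (ext_deriv1 A \<eta> p (J p))) \<and>
    (\<forall>I c. integral_curve A J I c \<longrightarrow>
       (\<forall>t\<in>I. g (c t) (J (c t)) (\<xi> (c t)) \<noteq> 0) \<longrightarrow>
       (\<forall>t0\<in>I. charged_particle_orbit A g D (ext_deriv1 A \<eta>)
          ((-1) powi (int r - 1) * b * g (c t0) (J (c t0)) (\<xi> (c t0))) I c))"
proof -
  have "pseudo_sasakian r A \<phi> \<xi> \<eta> g" and atlas: "smooth_atlas A" and D: "levi_civita A g D"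
    using assms(2) by (auto simp: sasakian_space_form_def)
  then obtain g' where g': "contact_metric A \<phi> \<xi> \<eta> g'"
    and g: "\<And>p v w. v \<in> tangent_space A p \<Longrightarrow> w \<in> tangent_space A p \<Longrightarrow>
      g p v w = (if r = 0 then g' p v w else g' p v w - 2 * \<eta> p v * \<eta> p w)"
    unfolding pseudo_sasakian_def sasakian_def by blast
  have \<xi>: "vector_field A \<xi>" and \<eta>: "one_form A \<eta>" and B': "bilinear_field A g'"
    and \<eta>\<xi>: "\<And>p. \<eta> p (\<xi> p) = 1"
    using g' unfolding contact_metric_def riemannian_metric_def by blast+
  have frame: "frame A e" and e1: "e 1 = \<xi>"
    and ge: "\<And>p i j. g p (e i p) (e j p) = hmat r $ i $ j"
    and br: "\<And>p. lie_bracket (e 1) (e 2) p = (- ((H + (-1) ^ r * 3) / 2)) \<odot>\<^sub>t e 3 p"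
      "\<And>p. lie_bracket (e 1) (e 3) p = ((H + (-1) ^ r * 3) / 2) \<odot>\<^sub>t e 2 p"
      "\<And>p. lie_bracket (e 2) (e 3) p = (-2) \<odot>\<^sub>t e 1 p"
    using assms(3) unfolding sasakian_frame_def by blast+
  have e: "e i p \<in> tangent_space A p" for i p
    using frame vector_fieldD(1) by (auto simp: frame_def)
  have "bilinear_field A g"
  proof -
    have "smooth_fun A (\<lambda>p. g p (X p) (Y p))" if "vector_field A X" "vector_field A Y" for X Y
    proof -
      note S = bilinear_fieldD(5)[OF B' that] one_formD(3)[OF \<eta> that(1)] one_formD(3)[OF \<eta> that(2)]
      have "smooth_fun A (\<lambda>p. g' p (X p) (Y p) - 2 * (\<eta> p (X p) * \<eta> p (Y p)))"
        by (intro smooth_fun_diff smooth_fun_cmult smooth_fun_mult atlas S)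
      then show ?thesis
        using S(1) that by (cases "r = 0") (simp_all add: g vector_fieldD(1) mult.assoc)
    qed
    then show ?thesis
      unfolding bilinear_field_def
      by (simp add: g tangent_space_plus tangent_space_scale bilinear_fieldD(1-4)[OF B']
          one_formD(1,2)[OF \<eta>] algebra_simps)
  qed
  \<comment> \<open>The identity \<eta> = g'(-, \<xi>) concerns \<open>g'\<close>, while the frame
    is orthonormal for \<open>g\<close>. Since g(v, \<xi>) = (-1)^r \<eta>(v), the sign cancels
    against the entry of \<open>hmat\<close> at the Reeb direction.\<close>
  moreover have "\<eta> p (e i p) = (if i = 1 then 1 else 0)" for p i
    using g[OF e[of i p] e[of 1 p]] ge[of p i 1] contact_metric_eta[OF g' e[of i p]] \<eta>\<xi>[of p] e1
    by (auto simp: hmat_def split: if_splits)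
  moreover have "g p (e i p) (e j p) = (if i = j then hmat r $ i $ i else 0)" for p i j
    by (simp add: ge) (simp add: hmat_def)
  ultimately interpret sasakian_sqk_spinor_frame A e g "\<lambda>i. hmat r $ i $ i" r H a b \<xi> \<eta> \<psi>
    using assms(1,4) atlas frame e1 \<eta> br by unfold_locales (simp_all add: hmat_def)
  have "\<exists>k. \<forall>t\<in>I. g (c t) (J (c t)) (\<xi> (c t)) = k" if "integral_curve A J I c" for I c
    using dirac_current_reeb_constant[OF that] unfolding metric_dirac_current_reeb by metis
  then show ?thesis
    unfolding Let_def using levi_civita_dirac_current[OF D] integral_curve_charged_particle[OF D] by blast
qed

end
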